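(* Let $G$ be a group, let $\mathbb{H}$ be a family of non-trivial subgroups of $G$, and let $K$ and $L$ be subgroups of $G$. Suppose that $G$ is hyperbolic relative to $\mathbb{H}$. If both $K$ and $L$ are quasiconvex relative to $\mathbb{H}$ in $G$, then $K\cap L$ is also quasiconvex relative to $\mathbb{H}$ in $G$.
   Context: Families: $\mathbb{H}$ is an indexed family of non-trivial subgroups of $G$; it may be empty or infinite, and two members may coincide as subgroups. $G$ may be uncountable. Systems: a system of $G$ is a set $X$ with a map $X\to G$ (elements of $X$ are regarded as elements of $G$; distinct elements of $X$ may give the same element of $G$). Every system is assumed symmetric: $X$ has an involution $x\mapsto x^{-1}$ compatible with inversion in $G$. Put $\mathcal H=\bigsqcup_{H\in\mathbb{H}}(H\setminus\{1\})$. Let $F=F(X)\ast(\ast_{H\in\mathbb{H}}H)$, where $F(X)$ is the free group generated by $X$ (the letter $x^{-1}$ representing the inverse of $x$). $X$ is a relative generating system of $(G,\mathbb{H})$ if the natural homomorphism $\psi\colon F\to G$ is surjective, i.e. $X\sqcup\mathcal H$ generates $G$. Relative Cayley graph: $\overline{\Gamma}(G,\mathbb{H},X)$ has vertex set $G$ and edge set $G\times(X\sqcup\mathcal H)$, the edge $(g,z)$ going from $g$ to $gz$. Relative hyperbolicity (Osin): $(X\sqcup\mathcal H)^\ast$ denotes the set of words over $X\sqcup\mathcal H$; $\|W\|$ is word length, and $W_1=_FW_2$ means equality in $F$. A word is reduced if it has minimal length among words representing the same element of $F$. A relative presentation of $(G,\mathbb{H})$ is a pair $(X,\mathcal R)$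 with $X$ a relative generating system and $\mathcal R\subset(X\sqcup\mathcal H)^\ast$ such that the normal closure of the image of $\mathcal R$ in $F$ is $\ker\psi$; $\mathcal R$ is assumed to consist of reduced words and to be closed under inverses and cyclic shifts. It is finite if $X$ and $\mathcal R$ are finite. For a word $W$ representing $1$ in $G$, $\mathrm{Area}^{rel}(W)$ is the smallest $k$ with $W=_F\prod_{i=1}^k f_i^{-1}R_if_i$, $f_i\in (X\sqcup\mathcal H)^\ast$, $R_i\in\mathcal R$. The relative Dehn function is $n\mapsto\max\{\mathrm{Area}^{rel}(W)\mid \|W\|\le n,\ W=1 \text{ in } G\}$ (well-defined if these maxima exist). $G$ is hyperbolic relative to $\mathbb{H}$ if $(G,\mathbb{H})$ has a finite relative presentation whose relative Dehn function is linear (i.e. well-defined and bounded above by a linear function). Condition $(b)$: a subgroup $L$ satisfies Condition $(b)$ with respect to $\mathbb{H}$ in $G$ if for all $y,y'\in G$ with $Ly\ne Ly'$, the set $\{H\in\mathbb{H}\mid L\cap yHy'^{-1}\neq\emptyset\}$ is finite. Relative quasiconvexity (for $G$ hyperbolic relative to $\mathbb{H}$): $L$ is pre-quasiconvex relative to $\mathbb{H}$ in $G$ if for some finite relative generating system $X$ of $(G,\mathbb{H})$ there is a finite subset $Y\subset G$ such that for any distinct $l_1,l_2\in L$ and any geodesic $c$ in $\overline{\Gamma}(G,\mathbb{H},X)$ from $l_1$ to $l_2$, all vertices on $c$ lie in $L\cup LY$, where $LY=\{ly\mid l\in L,y\in Y\}$. $L$ is quasiconvex relative to $\mathbb{H}$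 in $G$ if it is pre-quasiconvex relative to $\mathbb{H}$ in $G$ and satisfies Condition $(b)$ with respect to $\mathbb{H}$ in $G$. *)

theory Defs
  imports "HOL-Algebra.Coset" "Graph_Theory.Arc_Walk"
begin

text \<open>
  A family of subgroups of \<open>G\<close> is an index set \<open>I\<close> together with a map \<open>H\<close> from indices to
  subgroups. A system is an arbitrary set of letters with a not necessarily injective map
  to \<open>G\<close> and an involution realising formal inversion.
\<close>

record ('x, 'a) system =
  letters :: "'x set"
  val :: "'x \<Rightarrow> 'a"
  linv :: "'x \<Rightarrow> 'x"

definition is_system :: "('a, 'b) monoid_scheme \<Rightarrow> ('x, 'a) system \<Rightarrow> bool" where
  "is_system G X \<longleftrightarrow>
     (\<forall>x\<in>letters X. val X x \<in> carrier G \<and> linv X x \<in> letters X \<and>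
        linv X (linv X x) = x \<and> val X (linv X x) = inv\<^bsub>G\<^esub> (val X x))"


text \<open>
  The disjoint union of \<open>X\<close> and of the sets \<open>H i - {1}\<close>; the index is part of a peripheral letter,
  so equal elements of different members of the family give different letters.
\<close>

datatype ('x, 'i, 'a) letter = Gen 'x | Per 'i 'a

definition alphabet ::
  "('a, 'b) monoid_scheme \<Rightarrow> 'i set \<Rightarrow> ('i \<Rightarrow> 'a set) \<Rightarrow> ('x, 'a) system \<Rightarrow> ('x, 'i, 'a) letter set" where
  "alphabet G I H X = Gen ` letters X \<union> {Per i h | i h. i \<in> I \<and> h \<in> H i - {\<one>\<^bsub>G\<^esub>}}"

fun letter_val :: "('x, 'a) system \<Rightarrow> ('x, 'i, 'a) letter \<Rightarrow> 'a" where
  "letter_val X (Gen x) = val X x"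
| "letter_val X (Per i h) = h"

fun letter_inv ::
  "('a, 'b) monoid_scheme \<Rightarrow> ('x, 'a) system \<Rightarrow> ('x, 'i, 'a) letter \<Rightarrow> ('x, 'i, 'a) letter" where
  "letter_inv G X (Gen x) = Gen (linv X x)"
| "letter_inv G X (Per i h) = Per i (inv\<^bsub>G\<^esub> h)"

type_synonym ('x, 'i, 'a) word = "('x, 'i, 'a) letter list"

definition word_val :: "('a, 'b) monoid_scheme \<Rightarrow> ('x, 'a) system \<Rightarrow> ('x, 'i, 'a) word \<Rightarrow> 'a" where
  "word_val G X w = foldr (\<lambda>z g. letter_val X z \<otimes>\<^bsub>G\<^esub> g) w \<one>\<^bsub>G\<^esub>"

definition word_inv ::
  "('a, 'b) monoid_scheme \<Rightarrow> ('x, 'a) system \<Rightarrow> ('x, 'i, 'a) word \<Rightarrow> ('x, 'i, 'a) word" where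
  "word_inv G X w = rev (map (letter_inv G X) w)"


text \<open>
  Equality of words in the free product \<open>F\<close> of \<open>F(X)\<close> and all \<open>H i\<close>: the congruence generated by
  cancellation of mutually inverse letters of \<open>X\<close> and by the multiplication tables of the \<open>H i\<close>
  (whose identities are not letters, which is why there are two rules for them).
  Should the involution fix a letter \<open>x\<close>, the rule \<open>gen\<close> makes \<open>x\<close> its own inverse in \<open>F\<close>.
\<close>

inductive eqF ::
  "('a, 'b) monoid_scheme \<Rightarrow> 'i set \<Rightarrow> ('i \<Rightarrow> 'a set) \<Rightarrow> ('x, 'a) system \<Rightarrow>
   ('x, 'i, 'a) word \<Rightarrow> ('x, 'i, 'a) word \<Rightarrow> bool"
  for G I H X where
  refl: "w \<in> lists (alphabet G I H X) \<Longrightarrow> eqF G I H X w w"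
| sym: "eqF G I H X v w \<Longrightarrow> eqF G I H X w v"
| trans: "eqF G I H X u v \<Longrightarrow> eqF G I H X v w \<Longrightarrow> eqF G I H X u w"
| append: "eqF G I H X u u' \<Longrightarrow> eqF G I H X v v' \<Longrightarrow> eqF G I H X (u @ v) (u' @ v')"
| gen: "x \<in> letters X \<Longrightarrow> linv X x \<in> letters X \<Longrightarrow> eqF G I H X [Gen x, Gen (linv X x)] []"
| per_mult: "i \<in> I \<Longrightarrow> h \<in> H i - {\<one>\<^bsub>G\<^esub>} \<Longrightarrow> k \<in> H i - {\<one>\<^bsub>G\<^esub>} \<Longrightarrow> h \<otimes>\<^bsub>G\<^esub> k \<in> H i - {\<one>\<^bsub>G\<^esub>} \<Longrightarrow>
    eqF G I H X [Per i h, Per i k] [Per i (h \<otimes>\<^bsub>G\<^esub> k)]"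
| per_inv: "i \<in> I \<Longrightarrow> h \<in> H i - {\<one>\<^bsub>G\<^esub>} \<Longrightarrow> k \<in> H i - {\<one>\<^bsub>G\<^esub>} \<Longrightarrow> h \<otimes>\<^bsub>G\<^esub> k = \<one>\<^bsub>G\<^esub> \<Longrightarrow>
    eqF G I H X [Per i h, Per i k] []"

definition cls ::
  "('a, 'b) monoid_scheme \<Rightarrow> 'i set \<Rightarrow> ('i \<Rightarrow> 'a set) \<Rightarrow> ('x, 'a) system \<Rightarrow>
   ('x, 'i, 'a) word \<Rightarrow> ('x, 'i, 'a) word set" where
  "cls G I H X w = {v. eqF G I H X w v}"

definition freeF ::
  "('a, 'b) monoid_scheme \<Rightarrow> 'i set \<Rightarrow> ('i \<Rightarrow> 'a set) \<Rightarrow> ('x, 'a) system \<Rightarrow>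
   ('x, 'i, 'a) word set monoid" where
  "freeF G I H X =
     \<lparr>carrier = cls G I H X ` lists (alphabet G I H X),
      mult = (\<lambda>A B. \<Union>u\<in>A. \<Union>v\<in>B. cls G I H X (u @ v)),
      one = cls G I H X []\<rparr>"

text \<open>
  The natural homomorphism; \<open>word_val\<close> is constant on each class, see \<open>psi_cls\<close> below.
\<close>

definition psi ::
  "('a, 'b) monoid_scheme \<Rightarrow> ('x, 'a) system \<Rightarrow> ('x, 'i, 'a) word set \<Rightarrow> 'a" where
  "psi G X A = the_elem (word_val G X ` A)"

definition rel_gen_system ::
  "('a, 'b) monoid_scheme \<Rightarrow> 'i set \<Rightarrow> ('i \<Rightarrow> 'a set) \<Rightarrow> ('x, 'a) system \<Rightarrow> bool" where
  "rel_gen_system G I H X \<longleftrightarrow>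
     is_system G X \<and> psi G X ` carrier (freeF G I H X) = carrier G"


definition normal_closure :: "('a, 'b) monoid_scheme \<Rightarrow> 'a set \<Rightarrow> 'a set" where
  "normal_closure F S = \<Inter>{N. N \<lhd> F \<and> S \<subseteq> N}"

definition reduced_word ::
  "('a, 'b) monoid_scheme \<Rightarrow> 'i set \<Rightarrow> ('i \<Rightarrow> 'a set) \<Rightarrow> ('x, 'a) system \<Rightarrow>
   ('x, 'i, 'a) word \<Rightarrow> bool" where
  "reduced_word G I H X w \<longleftrightarrow> (\<forall>v. eqF G I H X w v \<longrightarrow> length w \<le> length v)"

definition rel_presentation ::
  "('a, 'b) monoid_scheme \<Rightarrow> 'i set \<Rightarrow> ('i \<Rightarrow> 'a set) \<Rightarrow> ('x, 'a) system \<Rightarrow>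
   ('x, 'i, 'a) word set \<Rightarrow> bool" where
  "rel_presentation G I H X R \<longleftrightarrow>
     rel_gen_system G I H X \<and>
     R \<subseteq> lists (alphabet G I H X) \<and>
     normal_closure (freeF G I H X) (cls G I H X ` R) = kernel (freeF G I H X) G (psi G X) \<and>
     (\<forall>w\<in>R. reduced_word G I H X w) \<and>
     (\<forall>w\<in>R. word_inv G X w \<in> R) \<and>
     (\<forall>w\<in>R. \<forall>n. rotate n w \<in> R)"

definition area_rel ::
  "('a, 'b) monoid_scheme \<Rightarrow> 'i set \<Rightarrow> ('i \<Rightarrow> 'a set) \<Rightarrow> ('x, 'a) system \<Rightarrow>
   ('x, 'i, 'a) word set \<Rightarrow> ('x, 'i, 'a) word \<Rightarrow> nat" where
  "area_rel G I H X R w =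
     (LEAST k. \<exists>ps. length ps = k \<and> set ps \<subseteq> lists (alphabet G I H X) \<times> R \<and>
        eqF G I H X w (concat (map (\<lambda>(f, r). word_inv G X f @ r @ f) ps)))"

definition dehn_areas ::
  "('a, 'b) monoid_scheme \<Rightarrow> 'i set \<Rightarrow> ('i \<Rightarrow> 'a set) \<Rightarrow> ('x, 'a) system \<Rightarrow>
   ('x, 'i, 'a) word set \<Rightarrow> nat \<Rightarrow> nat set" where
  "dehn_areas G I H X R n =
     {area_rel G I H X R w | w. w \<in> lists (alphabet G I H X) \<and> length w \<le> n \<and>
        word_val G X w = \<one>\<^bsub>G\<^esub>}"

text \<open>
  Since \<open>dehn_areas\<close> always contains the area of the empty word, its maximum exists iff it is finite.
\<close>

definition rel_dehn_well_defined ::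
  "('a, 'b) monoid_scheme \<Rightarrow> 'i set \<Rightarrow> ('i \<Rightarrow> 'a set) \<Rightarrow> ('x, 'a) system \<Rightarrow>
   ('x, 'i, 'a) word set \<Rightarrow> bool" where
  "rel_dehn_well_defined G I H X R \<longleftrightarrow> (\<forall>n. finite (dehn_areas G I H X R n))"

definition rel_dehn ::
  "('a, 'b) monoid_scheme \<Rightarrow> 'i set \<Rightarrow> ('i \<Rightarrow> 'a set) \<Rightarrow> ('x, 'a) system \<Rightarrow>
   ('x, 'i, 'a) word set \<Rightarrow> nat \<Rightarrow> nat" where
  "rel_dehn G I H X R n = Max (dehn_areas G I H X R n)"

text \<open>
  A finite system is, up to renaming its letters, a system whose letters are natural numbers.
\<close>

definition rel_hyperbolic ::
  "('a, 'b) monoid_scheme \<Rightarrow> 'i set \<Rightarrow> ('i \<Rightarrow> 'a set) \<Rightarrow> bool" where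
  "rel_hyperbolic G I H \<longleftrightarrow>
     (\<exists>(X :: (nat, 'a) system) R.
        finite (letters X) \<and> finite R \<and> rel_presentation G I H X R \<and>
        rel_dehn_well_defined G I H X R \<and>
        (\<exists>a b :: real. \<forall>n. real (rel_dehn G I H X R n) \<le> a * real n + b))"


text \<open>
  The arcs are closed under reversal because the alphabet is, so directed walks have the same
  vertex sequences as edge paths in the underlying graph.
\<close>

definition rel_cayley_graph ::
  "('a, 'b) monoid_scheme \<Rightarrow> 'i set \<Rightarrow> ('i \<Rightarrow> 'a set) \<Rightarrow> ('x, 'a) system \<Rightarrow>
   ('a, 'a \<times> ('x, 'i, 'a) letter) pre_digraph" where
  "rel_cayley_graph G I H X =
     \<lparr>verts = carrier G,
      arcs = carrier G \<times> alphabet G I H X,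
      tail = fst,
      head = (\<lambda>(g, z). g \<otimes>\<^bsub>G\<^esub> letter_val X z)\<rparr>"

definition geodesic :: "('v, 'e) pre_digraph \<Rightarrow> 'v \<Rightarrow> 'e awalk \<Rightarrow> 'v \<Rightarrow> bool" where
  "geodesic \<Gamma> u c v \<longleftrightarrow>
     pre_digraph.awalk \<Gamma> u c v \<and> (\<forall>p. pre_digraph.awalk \<Gamma> u p v \<longrightarrow> length c \<le> length p)"

definition pre_quasiconvex ::
  "('a, 'b) monoid_scheme \<Rightarrow> 'i set \<Rightarrow> ('i \<Rightarrow> 'a set) \<Rightarrow> 'a set \<Rightarrow> bool" where
  "pre_quasiconvex G I H L \<longleftrightarrow>
     (\<exists>X :: (nat, 'a) system. finite (letters X) \<and> rel_gen_system G I H X \<and>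
        (\<exists>Y \<subseteq> carrier G. finite Y \<and>
           (\<forall>l1\<in>L. \<forall>l2\<in>L. l1 \<noteq> l2 \<longrightarrow>
              (\<forall>c. geodesic (rel_cayley_graph G I H X) l1 c l2 \<longrightarrow>
                 set (pre_digraph.awalk_verts (rel_cayley_graph G I H X) l1 c)
                   \<subseteq> L \<union> (L <#>\<^bsub>G\<^esub> Y)))))"

text \<open>
  The finiteness is that of a subfamily, hence of a set of indices.
\<close>

definition condition_b ::
  "('a, 'b) monoid_scheme \<Rightarrow> 'i set \<Rightarrow> ('i \<Rightarrow> 'a set) \<Rightarrow> 'a set \<Rightarrow> bool" where
  "condition_b G I H L \<longleftrightarrow>
     (\<forall>y\<in>carrier G. \<forall>y'\<in>carrier G. L #>\<^bsub>G\<^esub> y \<noteq> L #>\<^bsub>G\<^esub> y' \<longrightarrow>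
        finite {i \<in> I. L \<inter> ((y <#\<^bsub>G\<^esub> H i) #>\<^bsub>G\<^esub> inv\<^bsub>G\<^esub> y') \<noteq> {}})"

definition rel_quasiconvex ::
  "('a, 'b) monoid_scheme \<Rightarrow> 'i set \<Rightarrow> ('i \<Rightarrow> 'a set) \<Rightarrow> 'a set \<Rightarrow> bool" where
  "rel_quasiconvex G I H L \<longleftrightarrow> pre_quasiconvex G I H L \<and> condition_b G I H L"


text \<open>Well-definedness of \<open>freeF\<close> and \<open>psi\<close>.\<close>

lemma eqF_words:
  assumes "eqF G I H X u v"
  shows "u \<in> lists (alphabet G I H X) \<and> v \<in> lists (alphabet G I H X)"
  using assms by induction (auto simp: alphabet_def)

lemma cls_eq_iff:
  assumes "v \<in> lists (alphabet G I H X)"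
  shows "cls G I H X u = cls G I H X v \<longleftrightarrow> eqF G I H X u v"
proof
  assume "cls G I H X u = cls G I H X v"
  moreover have "v \<in> cls G I H X v" using assms by (simp add: cls_def eqF.refl)
  ultimately show "eqF G I H X u v" unfolding cls_def by blast
next
  assume "eqF G I H X u v"
  then show "cls G I H X u = cls G I H X v"
    unfolding cls_def by (blast dest: eqF.sym eqF.trans)
qed

lemma freeF_mult:
  assumes "u \<in> lists (alphabet G I H X)" "v \<in> lists (alphabet G I H X)"
  shows "cls G I H X u \<otimes>\<^bsub>freeF G I H X\<^esub> cls G I H X v = cls G I H X (u @ v)"
proof -
  have *: "cls G I H X (u' @ v') = cls G I H X (u @ v)"
    if "u' \<in> cls G I H X u" "v' \<in> cls G I H X v" for u' v'
  proof -
    have "eqF G I H X (u' @ v') (u @ v)"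
      using that by (intro eqF.append) (simp_all add: cls_def eqF.sym)
    moreover have "u @ v \<in> lists (alphabet G I H X)" using assms by simp
    ultimately show ?thesis using cls_eq_iff by blast
  qed
  have ne: "u \<in> cls G I H X u" "v \<in> cls G I H X v"
    using assms by (simp_all add: cls_def eqF.refl)
  have "(\<Union>u'\<in>cls G I H X u. \<Union>v'\<in>cls G I H X v. cls G I H X (u' @ v'))
      = (\<Union>u'\<in>cls G I H X u. \<Union>v'\<in>cls G I H X v. cls G I H X (u @ v))"
    using * by (intro SUP_cong HOL.refl) simp
  also have "\<dots> = cls G I H X (u @ v)"
    using ne by auto
  finally show ?thesis by (simp add: freeF_def)
qed

locale peripheral_system = group G for G (structure) +
  fixes I :: "'i set" and H :: "'i \<Rightarrow> 'a set" and X :: "('x, 'a) system"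
  assumes sub: "i \<in> I \<Longrightarrow> subgroup (H i) G"
    and sys: "is_system G X"
begin

lemma letter_val_closed: "z \<in> alphabet G I H X \<Longrightarrow> letter_val X z \<in> carrier G"
  using sys by (auto simp: alphabet_def is_system_def intro: subgroup.mem_carrier[OF sub])

lemma word_val_closed: "w \<in> lists (alphabet G I H X) \<Longrightarrow> word_val G X w \<in> carrier G"
  by (induction w) (auto simp: word_val_def letter_val_closed)

lemma word_val_append:
  assumes "u \<in> lists (alphabet G I H X)" "v \<in> lists (alphabet G I H X)"
  shows "word_val G X (u @ v) = word_val G X u \<otimes> word_val G X v"
  using assms
proof (induction u)
  case Nil
  then show ?case using word_val_closed[of v] by (simp add: word_val_def)
next
  case (Cons z u)
  then show ?case
    using word_val_closed[of u] word_val_closed[of v] letter_val_closed[of z]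
    by (simp add: word_val_def m_assoc)
qed

lemma word_val_eqF: "eqF G I H X u v \<Longrightarrow> word_val G X u = word_val G X v"
proof (induction rule: eqF.induct)
  case (append u u' v v')
  then show ?case by (metis eqF_words word_val_append)
next
  case (gen x)
  then show ?case using sys by (auto simp: word_val_def is_system_def)
next
  case (per_mult i h k)
  then have "h \<in> carrier G" "k \<in> carrier G"
    using subgroup.mem_carrier[OF sub] by blast+
  then show ?case by (simp add: word_val_def)
next
  case (per_inv i h k)
  then have "h \<in> carrier G" "k \<in> carrier G"
    using subgroup.mem_carrier[OF sub] by blast+
  then show ?case using per_inv by (simp add: word_val_def)
qed auto

lemma psi_cls:
  assumes "w \<in> lists (alphabet G I H X)"
  shows "psi G X (cls G I H X w) = word_val G X w"
proof -
  have "word_val G X ` cls G I H X w = {word_val G X w}"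
    using assms word_val_eqF by (auto simp: cls_def intro!: image_eqI[of _ _ w] eqF.refl)
  then show ?thesis by (simp add: psi_def)
qed

lemma letter_inv_closed: "z \<in> alphabet G I H X \<Longrightarrow> letter_inv G X z \<in> alphabet G I H X"
  using sys sub
  by (auto simp: alphabet_def is_system_def subgroup.m_inv_closed)
     (metis inv_one inv_inv subgroup.mem_carrier)

lemma word_inv_closed:
  "w \<in> lists (alphabet G I H X) \<Longrightarrow> word_inv G X w \<in> lists (alphabet G I H X)"
  by (auto simp: word_inv_def letter_inv_closed)

lemma letter_inv_left:
  assumes "z \<in> alphabet G I H X"
  shows "eqF G I H X [letter_inv G X z, z] []"
proof (cases z)
  case (Gen x)
  then have "x \<in> letters X" using assms by (auto simp: alphabet_def)
  then show ?thesis
    using sys eqF.gen[of "linv X x" X G I H] Gen by (auto simp: is_system_def)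
next
  case (Per i h)
  then have h: "i \<in> I" "h \<in> H i - {\<one>}" using assms by (auto simp: alphabet_def)
  then have "inv h \<in> H i - {\<one>}" "h \<in> carrier G"
    using letter_inv_closed[OF assms] Per sub by (auto simp: alphabet_def dest: subgroup.mem_carrier)
  then show ?thesis using h Per by (auto intro: eqF.per_inv)
qed

lemma word_inv_left:
  "w \<in> lists (alphabet G I H X) \<Longrightarrow> eqF G I H X (word_inv G X w @ w) []"
proof (induction w)
  case Nil
  then show ?case by (auto simp: word_inv_def intro: eqF.refl)
next
  case (Cons z w)
  have "eqF G I H X ((word_inv G X w @ [letter_inv G X z, z]) @ w) ((word_inv G X w @ []) @ w)"
    using Cons word_inv_closed[of w] by (intro eqF.append eqF.refl letter_inv_left) auto
  moreover have "eqF G I H X (word_inv G X w @ w) []" using Cons by simp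
  ultimately have "eqF G I H X ((word_inv G X w @ [letter_inv G X z, z]) @ w) []"
    using eqF.trans by fastforce
  then show ?case by (simp add: word_inv_def)
qed

lemma group_freeF: "group (freeF G I H X)"
proof (rule groupI)
  let ?F = "freeF G I H X" and ?A = "lists (alphabet G I H X)"
  have carr: "carrier ?F = cls G I H X ` ?A" and one: "\<one>\<^bsub>?F\<^esub> = cls G I H X []"
    by (simp_all add: freeF_def)
  show "\<one>\<^bsub>?F\<^esub> \<in> carrier ?F" by (auto simp: carr one)
  fix a assume "a \<in> carrier ?F"
  then obtain u where u: "u \<in> ?A" "a = cls G I H X u" by (auto simp: carr)
  show "\<one>\<^bsub>?F\<^esub> \<otimes>\<^bsub>?F\<^esub> a = a" using u by (simp add: one freeF_mult)
  have "cls G I H X (word_inv G X u) \<otimes>\<^bsub>?F\<^esub> a = \<one>\<^bsub>?F\<^esub>"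
    using u word_inv_left[of u] word_inv_closed[of u]
    by (simp add: one freeF_mult cls_eq_iff)
  then show "\<exists>b\<in>carrier ?F. b \<otimes>\<^bsub>?F\<^esub> a = \<one>\<^bsub>?F\<^esub>"
    using u word_inv_closed[of u] by (auto simp: carr)
  fix b assume "b \<in> carrier ?F"
  then obtain v where v: "v \<in> ?A" "b = cls G I H X v" by (auto simp: carr)
  show "a \<otimes>\<^bsub>?F\<^esub> b \<in> carrier ?F"
    using u v by (simp add: freeF_mult carr)
  fix c assume "c \<in> carrier ?F"
  then obtain w where w: "w \<in> ?A" "c = cls G I H X w" by (auto simp: carr)
  have "u @ v \<in> ?A" "v @ w \<in> ?A" using u v w by auto
  then show "a \<otimes>\<^bsub>?F\<^esub> b \<otimes>\<^bsub>?F\<^esub> c = a \<otimes>\<^bsub>?F\<^esub> (b \<otimes>\<^bsub>?F\<^esub> c)"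
    using u v w by (simp add: freeF_mult del: append_in_lists_conv)
qed

lemma psi_hom: "psi G X \<in> hom (freeF G I H X) G"
proof (rule homI)
  let ?F = "freeF G I H X" and ?A = "lists (alphabet G I H X)"
  have carr: "carrier ?F = cls G I H X ` ?A" by (simp add: freeF_def)
  fix a assume "a \<in> carrier ?F"
  then obtain u where u: "u \<in> ?A" "a = cls G I H X u" by (auto simp: carr)
  show "psi G X a \<in> carrier G" using u psi_cls word_val_closed by simp
  fix b assume "b \<in> carrier ?F"
  then obtain v where v: "v \<in> ?A" "b = cls G I H X v" by (auto simp: carr)
  have "u @ v \<in> ?A" using u v by auto
  then show "psi G X (a \<otimes>\<^bsub>?F\<^esub> b) = psi G X a \<otimes> psi G X b"
    using u v by (simp add: freeF_mult psi_cls word_val_append del: append_in_lists_conv)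
qed

end

end

theory Submission
  imports Defs
begin

text \<open>
  If the geodesics that witness the quasiconvexity of \<open>K\<close> and of \<open>L\<close> were taken in the same relative
  Cayley graph, the statement would be elementary: a vertex of a geodesic between points of
  \<open>K \<inter> L\<close> lies in \<open>K A \<inter> L B\<close> with \<open>A\<close> and \<open>B\<close> finite, each \<open>K a \<inter> L b\<close> is empty or a coset of
  \<open>K \<inter> L\<close>, hence \<open>K A \<inter> L B\<close> is covered by finitely many such cosets
  (\<open>finite_coset_unions_inter\<close>). Condition (b) passes to intersections because \<open>(K \<inter> L) y \<noteq> (K \<inter> L) y'\<close>
  forces \<open>K y \<noteq> K y'\<close> or \<open>L y \<noteq> L y'\<close>. The work lies in moving from the two given relative generating
  systems to a common larger one \<open>V\<close> (\<open>words_stay_near_change_generators\<close>). For this it suffices that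
  a geodesic \<open>p\<close> over \<open>V\<close> stays in \<open>Q Y\<close>, with \<open>Y\<close> finite and independent of \<open>p\<close>, where \<open>Q\<close> is the
  vertex set of a geodesic over the smaller system with the same ends. The set \<open>Q\<close> is quasi-convex in the
  graph of \<open>V\<close>, and such stability (\<open>geodesic_stability\<close>) is what relative hyperbolicity gives.

  Stability is derived from the linear relative Dehn function by a Stokes argument instead of
  diagrams or thin triangles. Cone off every coset \<open>x H i\<close> in the Cayley graph and let \<open>f\<close> and \<open>u\<close> be
  real functions. The integral of \<open>f du\<close> along a word is invariant under equality in the free product
  \<open>F\<close>, because a product of two peripheral letters of the same index passes through the same cone
  point. If \<open>f\<close> changes by at most \<open>1\<close> along the finitely many letters in the relators and \<open>u\<close>
  along all edges of the coned-off graph, then the integral around a relator is bounded by a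
  constant. A closed word of length \<open>n\<close> is a product of linearly many conjugates of relators, so its
  integral is at most \<open>C n\<close> (\<open>linear_filling\<close>).

  Let \<open>f \<ge> 0\<close> vanish on \<open>Q\<close>, let \<open>u\<close> be the distance from a point of \<open>p\<close>, truncated so that
  it is constant outside the stretch of \<open>p\<close> between the indices \<open>s\<close> and \<open>t\<close>, and close up a slightly longer
  stretch of \<open>p\<close> through \<open>Q\<close>. Only \<open>p\<close> contributes to the integral, so the sum of \<open>f\<close> over that stretch
  is bounded linearly in \<open>t - s\<close> and in the distance of \<open>p\<close> from \<open>Q\<close> (\<open>cut_inequality\<close>).
  This is used twice. With \<open>f\<close> a tent of height \<open>r\<close> around the vertex of \<open>p\<close> farthest from \<open>Q\<close>, at
  distance \<open>r\<close>, the sum is quadratic in \<open>r\<close>, which bounds \<open>r\<close> (\<open>geodesic_near_quasi_convex\<close>). This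
  is a bound in the relative metric, whose balls may be infinite. With \<open>f\<close> a tent in the word metric of
  a finite set of group elements and a stretch of a single edge, the same inequality then bounds the height
  of the tent, which is the finiteness required of \<open>Y\<close>.
\<close>

section \<open>Words with values in the group\<close>

text \<open>
  All generating systems are compared inside the group: a letter of a system is replaced by its
  value. This changes neither the vertices of a path nor relative distances, and it turns the union
  of several systems into a union of sets.
\<close>

fun elt :: "('a, 'i, 'a) letter \<Rightarrow> 'a" where
  "elt (Gen s) = s"
| "elt (Per i h) = h"

definition plain_word :: "('x, 'a) system \<Rightarrow> ('x, 'i, 'a) word \<Rightarrow> ('a, 'i, 'a) word" where
  "plain_word X = map (map_letter (val X) (\<lambda>i. i) (\<lambda>h. h))"

lemma plain_word_simps [simp]:
  "plain_word X [] = []"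
  "plain_word X (z # w) = map_letter (val X) (\<lambda>i. i) (\<lambda>h. h) z # plain_word X w"
  "plain_word X (u @ v) = plain_word X u @ plain_word X v"
  "length (plain_word X w) = length w"
  by (simp_all add: plain_word_def)

lemma elt_map_letter [simp]: "elt (map_letter (val X) (\<lambda>i. i) (\<lambda>h. h) z) = letter_val X z"
  by (cases z) simp_all

locale peripheral_family = group G for G (structure) +
  fixes I :: "'i set" and H :: "'i \<Rightarrow> 'a set"
  assumes sub: "i \<in> I \<Longrightarrow> subgroup (H i) G"
begin

lemma H_closed: "i \<in> I \<Longrightarrow> h \<in> H i \<Longrightarrow> h \<in> carrier G"
  using subgroup.mem_carrier[OF sub] .

text \<open>
  The alphabet of the system whose letters are the elements of \<open>V\<close> themselves.
\<close>

definition plain_alph :: "'a set \<Rightarrow> ('a, 'i, 'a) letter set" where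
  "plain_alph V = Gen ` V \<union> {Per i h | i h. i \<in> I \<and> h \<in> H i - {\<one>}}"

definition end_pt :: "'a \<Rightarrow> ('a, 'i, 'a) word \<Rightarrow> 'a" where
  "end_pt g w = foldl (\<lambda>x z. x \<otimes> elt z) g w"

primrec path_verts :: "('a, 'i, 'a) word \<Rightarrow> 'a \<Rightarrow> 'a list" where
  "path_verts [] g = [g]"
| "path_verts (z # w) g = g # path_verts w (g \<otimes> elt z)"

lemma end_pt_simps [simp]:
  "end_pt g [] = g"
  "end_pt g (z # w) = end_pt (g \<otimes> elt z) w"
  "end_pt g (u @ v) = end_pt (end_pt g u) v"
  by (simp_all add: end_pt_def)

lemma elt_closed: "V \<subseteq> carrier G \<Longrightarrow> z \<in> plain_alph V \<Longrightarrow> elt z \<in> carrier G"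
  by (auto simp: plain_alph_def H_closed)

lemma plain_alph_mono: "V \<subseteq> V' \<Longrightarrow> plain_alph V \<subseteq> plain_alph V'"
  by (auto simp: plain_alph_def)

lemma end_pt_closed:
  "V \<subseteq> carrier G \<Longrightarrow> g \<in> carrier G \<Longrightarrow> w \<in> lists (plain_alph V) \<Longrightarrow> end_pt g w \<in> carrier G"
  by (induction w arbitrary: g) (auto simp: elt_closed)

lemma end_pt_left_mult:
  assumes "V \<subseteq> carrier G" "w \<in> lists (plain_alph V)" "a \<in> carrier G" "g \<in> carrier G"
  shows "end_pt (a \<otimes> g) w = a \<otimes> end_pt g w"
  using assms(2,4)
proof (induction w arbitrary: g)
  case (Cons z w)
  then have "elt z \<in> carrier G" using elt_closed assms(1) by auto
  then show ?case using Cons assms(3) Cons.IH[of "g \<otimes> elt z"] by (simp add: m_assoc)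
qed simp

lemma set_path_verts:
  "set (path_verts w g) = {end_pt g (take j w) | j. j \<le> length w}"
proof (induction w arbitrary: g)
  case (Cons z w)
  show ?case
  proof (intro Set.set_eqI iffI)
    fix x assume "x \<in> set (path_verts (z # w) g)"
    then consider "x = g" | "x \<in> set (path_verts w (g \<otimes> elt z))" by auto
    then show "x \<in> {end_pt g (take j (z # w)) | j. j \<le> length (z # w)}"
    proof cases
      case 1
      then show ?thesis by (auto intro!: exI[of _ 0])
    next
      case 2
      then obtain j where "j \<le> length w" "x = end_pt (g \<otimes> elt z) (take j w)"
        using Cons.IH by auto
      then show ?thesis by (auto intro!: exI[of _ "Suc j"])
    qed
  next
    fix x assume "x \<in> {end_pt g (take j (z # w)) | j. j \<le> length (z # w)}"
    then obtain j where "j \<le> length (z # w)" "x = end_pt g (take j (z # w))" by auto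
    then show "x \<in> set (path_verts (z # w) g)"
      using Cons.IH by (cases j) auto
  qed
qed simp

lemma path_verts_append:
  "set (path_verts (u @ v) g) = set (path_verts u g) \<union> set (path_verts v (end_pt g u))"
proof (induction u arbitrary: g)
  case Nil
  then show ?case by (cases v) auto
qed auto

lemma path_verts_ends: "g \<in> set (path_verts w g)" "end_pt g w \<in> set (path_verts w g)"
  by (induction w arbitrary: g) auto

lemma path_verts_closed:
  "V \<subseteq> carrier G \<Longrightarrow> g \<in> carrier G \<Longrightarrow> w \<in> lists (plain_alph V) \<Longrightarrow> set (path_verts w g) \<subseteq> carrier G"
  by (induction w arbitrary: g) (auto simp: elt_closed)

section \<open>Integrals along words in the coned-off Cayley graph\<close>

text \<open>
  The 1-cochain \<open>f du\<close> on the Cayley graph in which every coset \<open>x H i\<close> has been coned off: \<open>c i x\<close>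
  is the value of \<open>u\<close> at the cone point of \<open>x H i\<close>. An edge with a peripheral label consists of two
  halves that meet in that cone point; on each half the weight is the value of \<open>f\<close> at the end in the group.
\<close>

fun edge_int :: "('a \<Rightarrow> real) \<Rightarrow> ('a \<Rightarrow> real) \<Rightarrow> ('i \<Rightarrow> 'a \<Rightarrow> real) \<Rightarrow> 'a \<Rightarrow> ('a, 'i, 'a) letter \<Rightarrow> real"
  where
  "edge_int f u c g (Gen s) = (f g + f (g \<otimes> s)) / 2 * (u (g \<otimes> s) - u g)"
| "edge_int f u c g (Per i h) = f g * (c i g - u g) + f (g \<otimes> h) * (u (g \<otimes> h) - c i (g \<otimes> h))"

primrec path_int :: "('a \<Rightarrow> real) \<Rightarrow> ('a \<Rightarrow> real) \<Rightarrow> ('i \<Rightarrow> 'a \<Rightarrow> real) \<Rightarrow> ('a, 'i, 'a) word \<Rightarrow> 'a \<Rightarrow> real"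
  where
  "path_int f u c [] g = 0"
| "path_int f u c (z # w) g = edge_int f u c g z + path_int f u c w (g \<otimes> elt z)"

lemma path_int_append:
  "path_int f u c (v @ w) g = path_int f u c v g + path_int f u c w (end_pt g v)"
  by (induction v arbitrary: g) auto

lemma path_int_sum:
  "path_int f u c w g = (\<Sum>j<length w. edge_int f u c (end_pt g (take j w)) (w ! j))"
  by (induction w arbitrary: g) (simp_all add: sum.lessThan_Suc_shift del: sum.lessThan_Suc)

lemma path_int_zero:
  assumes "\<And>x. x \<in> set (path_verts w g) \<Longrightarrow> f x = 0"
  shows "path_int f u c w g = 0"
  using assms
proof (induction w arbitrary: g)
  case (Cons z w)
  have "f g = 0" "f (g \<otimes> elt z) = 0" using Cons.prems path_verts_ends(1)[of "g \<otimes> elt z" w] by auto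
  then have "edge_int f u c g z = 0" by (cases z) auto
  then show ?case using Cons by auto
qed simp

lemma path_int_flat:
  assumes "w \<in> lists (plain_alph V)"
    and "\<And>x. x \<in> set (path_verts w g) \<Longrightarrow> u x = k \<and> (\<forall>i\<in>I. c i x = k)"
  shows "path_int f u c w g = 0"
  using assms
proof (induction w arbitrary: g)
  case (Cons z w)
  have "u g = k" "u (g \<otimes> elt z) = k" "\<forall>i\<in>I. c i g = k" "\<forall>i\<in>I. c i (g \<otimes> elt z) = k"
    using Cons.prems path_verts_ends(1)[of "g \<otimes> elt z" w] by auto
  moreover have "z \<in> plain_alph V" using Cons.hyps(1) .
  ultimately have "edge_int f u c g z = 0" by (cases z) (auto simp: plain_alph_def)
  moreover have "path_int f u c w (g \<otimes> elt z) = 0"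
    using Cons.prems by (intro Cons.IH) auto
  ultimately show ?case by simp
qed simp

text \<open>
  The reversed path is obtained letter by letter; a cochain changes its sign on it.
\<close>

lemma reverse_path:
  assumes "V \<subseteq> carrier G" "\<forall>s\<in>V. inv s \<in> V" "g \<in> carrier G" "w \<in> lists (plain_alph V)"
  shows "\<exists>w'\<in>lists (plain_alph V). length w' = length w \<and> end_pt (end_pt g w) w' = g \<and>
    set (path_verts w' (end_pt g w)) = set (path_verts w g) \<and>
    (\<forall>f u c. path_int f u c w' (end_pt g w) = - path_int f u c w g)"
  using assms(3,4)
proof (induction w arbitrary: g rule: list.induct)
  case Nil
  then show ?case by (auto intro!: bexI[of _ "[]"])
next
  case (Cons z w)
  define z' where "z' = (case z of Gen s \<Rightarrow> Gen (inv s) | Per i h \<Rightarrow> Per i (inv h))"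
  have zc: "elt z \<in> carrier G" using Cons.prems elt_closed assms(1) by auto
  have z': "z' \<in> plain_alph V" "elt z' = inv (elt z)"
    using Cons.prems(2) assms(2) zc
    by (auto simp: z'_def plain_alph_def subgroup.m_inv_closed[OF sub] inv_eq_1_iff)
  have e: "edge_int f u c (g \<otimes> elt z) z' = - edge_int f u c g z" for f u c
    using zc Cons.prems(1) by (cases z) (auto simp: z'_def m_assoc field_simps)
  have "g \<otimes> elt z \<in> carrier G" using zc Cons.prems by auto
  moreover have "w \<in> lists (plain_alph V)" using Cons.prems(2) by simp
  ultimately obtain w' where w': "w' \<in> lists (plain_alph V)" "length w' = length w"
    "end_pt (end_pt (g \<otimes> elt z) w) w' = g \<otimes> elt z"
    "set (path_verts w' (end_pt (g \<otimes> elt z) w)) = set (path_verts w (g \<otimes> elt z))"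
    "\<forall>f u c. path_int f u c w' (end_pt (g \<otimes> elt z) w) = - path_int f u c w (g \<otimes> elt z)"
    using Cons.IH[of "g \<otimes> elt z"] by blast
  have "g \<otimes> elt z \<otimes> inv (elt z) = g" using zc Cons.prems by (simp add: m_assoc)
  then show ?case
    using w' z' e path_verts_ends(1)[of "g \<otimes> elt z" w]
    by (intro bexI[of _ "w' @ [z']"]) (auto simp: path_verts_append path_int_append)
qed

section \<open>The relative metric\<close>

definition rel_gen_set :: "'a set \<Rightarrow> bool" where
  "rel_gen_set V \<longleftrightarrow> V \<subseteq> carrier G \<and> (\<forall>s\<in>V. inv s \<in> V) \<and>
     (\<forall>x\<in>carrier G. \<forall>y\<in>carrier G. \<exists>w\<in>lists (plain_alph V). end_pt x w = y)"

definition rdist :: "'a set \<Rightarrow> 'a \<Rightarrow> 'a \<Rightarrow> nat" where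
  "rdist V x y = (LEAST n. \<exists>w\<in>lists (plain_alph V). length w = n \<and> end_pt x w = y)"

lemma rdist_le: "w \<in> lists (plain_alph V) \<Longrightarrow> rdist V x (end_pt x w) \<le> length w"
  unfolding rdist_def by (rule Least_le) auto

lemma rdist_attained:
  assumes "rel_gen_set V" "x \<in> carrier G" "y \<in> carrier G"
  obtains w where "w \<in> lists (plain_alph V)" "length w = rdist V x y" "end_pt x w = y"
proof -
  have "\<exists>n. \<exists>w\<in>lists (plain_alph V). length w = n \<and> end_pt x w = y"
    using assms unfolding rel_gen_set_def by blast
  from LeastI_ex[OF this] show ?thesis using that unfolding rdist_def by auto
qed

lemma rdist_refl [simp]: "rdist V x x = 0"
  using rdist_le[of "[]" V x] by simp

lemma rdist_triangle:
  assumes "rel_gen_set V" "x \<in> carrier G" "y \<in> carrier G" "z \<in> carrier G"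
  shows "rdist V x z \<le> rdist V x y + rdist V y z"
proof -
  obtain v where v: "v \<in> lists (plain_alph V)" "length v = rdist V x y" "end_pt x v = y"
    using rdist_attained[OF assms(1,2,3)] .
  obtain w where w: "w \<in> lists (plain_alph V)" "length w = rdist V y z" "end_pt y w = z"
    using rdist_attained[OF assms(1,3,4)] .
  have "v @ w \<in> lists (plain_alph V)" using v(1) w(1) by simp
  from rdist_le[OF this, of x] show ?thesis using v w by simp
qed

lemma rdist_sym:
  assumes "rel_gen_set V" "x \<in> carrier G" "y \<in> carrier G"
  shows "rdist V x y = rdist V y x"
proof -
  have "rdist V b a \<le> rdist V a b" if ab: "a \<in> carrier G" "b \<in> carrier G" for a b
  proof -
    obtain v where v: "v \<in> lists (plain_alph V)" "length v = rdist V a b" "end_pt a v = b"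
      using rdist_attained[OF assms(1) ab] .
    obtain w where "w \<in> lists (plain_alph V)" "length w = length v" "end_pt b w = a"
      using reverse_path[of V a v] assms(1) v ab unfolding rel_gen_set_def by auto
    then show ?thesis using rdist_le[of w V b] v by simp
  qed
  then show ?thesis using assms by (simp add: order_antisym)
qed

lemma rdist_step: "z \<in> plain_alph V \<Longrightarrow> rdist V x (x \<otimes> elt z) \<le> 1"
  using rdist_le[of "[z]" V x] by simp

lemma rdist_coset:
  assumes "i \<in> I" "h \<in> H i" "x \<in> carrier G"
  shows "rdist V x (x \<otimes> h) \<le> 1"
proof (cases "h = \<one>")
  case False
  then have "Per i h \<in> plain_alph V" using assms by (auto simp: plain_alph_def)
  then show ?thesis using rdist_step by fastforce
qed (use assms in simp)

lemma rdist_path_verts: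
  assumes "x \<in> set (path_verts w g)" "w \<in> lists (plain_alph V)"
  shows "rdist V g x \<le> length w" "rdist V x (end_pt g w) \<le> length w"
proof -
  obtain j where j: "j \<le> length w" "x = end_pt g (take j w)"
    using assms(1) set_path_verts by auto
  have l: "take j w \<in> lists (plain_alph V)" "drop j w \<in> lists (plain_alph V)"
    using assms(2) by (auto dest: in_set_takeD in_set_dropD)
  show "rdist V g x \<le> length w" using rdist_le[OF l(1), of g] j by simp
  have "end_pt x (drop j w) = end_pt g w"
    unfolding j by (simp flip: end_pt_simps(3))
  then show "rdist V x (end_pt g w) \<le> length w" using rdist_le[OF l(2), of x] by simp
qed

text \<open>
  If two vertices of a geodesic were closer than their indices say, a shortcut would join its ends.
\<close>

lemma rdist_geodesic_verts:
  assumes "rel_gen_set V" "g \<in> carrier G" "w \<in> lists (plain_alph V)" "length w = rdist V g (end_pt g w)"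
    and "i \<le> j" "j \<le> length w"
  shows "rdist V (end_pt g (take i w)) (end_pt g (take j w)) = j - i"
proof -
  let ?p = "\<lambda>i. end_pt g (take i w)"
  have V: "V \<subseteq> carrier G" using assms(1) by (simp add: rel_gen_set_def)
  have l: "take k w \<in> lists (plain_alph V)" "drop k w \<in> lists (plain_alph V)" for k
    using assms(3) by (auto dest: in_set_takeD in_set_dropD)
  have c: "?p k \<in> carrier G" for k using end_pt_closed[OF V assms(2) l(1)] .
  have 1: "rdist V g (?p i) \<le> i" using rdist_le[OF l(1)[of i], of g] assms by simp
  have t: "take j w = take i w @ take (j - i) (drop i w)"
    using assms(5) take_add[of i "j - i" w] by simp
  have "take (j - i) (drop i w) \<in> lists (plain_alph V)"
    using l(2)[of i] by (auto dest: in_set_takeD)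
  from rdist_le[OF this, of "?p i"] t have 2: "rdist V (?p i) (?p j) \<le> j - i" by simp
  have "end_pt (?p j) (drop j w) = end_pt g w"
    by (simp flip: end_pt_simps(3))
  then have 3: "rdist V (?p j) (end_pt g w) \<le> length w - j"
    using rdist_le[OF l(2)[of j], of "?p j"] by simp
  have "end_pt g w \<in> carrier G" using end_pt_closed[OF V assms(2,3)] .
  then have "rdist V g (end_pt g w) \<le> rdist V g (?p i) + rdist V (?p i) (end_pt g w)"
    "rdist V (?p i) (end_pt g w) \<le> rdist V (?p i) (?p j) + rdist V (?p j) (end_pt g w)"
    using rdist_triangle[OF assms(1)] c assms(2) by blast+
  then show ?thesis using 1 2 3 assms by linarith
qed

lemma rdist_lipschitz:
  assumes "x \<in> carrier G" "y \<in> carrier G" "z \<in> carrier G" "rel_gen_set V" "rdist V x y \<le> 1"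
  shows "\<bar>real (rdist V z x) - real (rdist V z y)\<bar> \<le> 1"
  using rdist_triangle[OF assms(4,3,1,2)] rdist_triangle[OF assms(4,3,2,1)] assms(5)
    rdist_sym[OF assms(4,1,2)] by linarith

section \<open>The linear isoperimetric inequality as a Stokes inequality\<close>

text \<open>
  The weight \<open>f\<close> is restricted only along a set \<open>S\<close> of group elements, which will be finite. It may
  vary arbitrarily along the other peripheral edges, so that it may be built from a word metric
  with finite balls.
\<close>

definition lipschitz :: "'a set \<Rightarrow> ('a \<Rightarrow> real) \<Rightarrow> bool" where
  "lipschitz S f \<longleftrightarrow> (\<forall>x\<in>carrier G. \<forall>s\<in>S. \<bar>f (x \<otimes> s) - f x\<bar> \<le> 1)"

text \<open>
  In contrast to the weight, the potential \<open>u\<close>, extended by \<open>c\<close> to the cone points, varies by at most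
  \<open>1\<close> along every edge of the coned-off graph, including those to the cone points. Constancy of \<open>c i\<close>
  on cosets is what makes it a function on cone points.
\<close>

definition potential :: "'a set \<Rightarrow> ('a \<Rightarrow> real) \<Rightarrow> ('i \<Rightarrow> 'a \<Rightarrow> real) \<Rightarrow> bool" where
  "potential V u c \<longleftrightarrow> (\<forall>x\<in>carrier G. \<forall>s\<in>V. \<bar>u (x \<otimes> s) - u x\<bar> \<le> 1) \<and>
     (\<forall>i\<in>I. \<forall>x\<in>carrier G. \<bar>c i x - u x\<bar> \<le> 1 \<and> (\<forall>h\<in>H i. c i (x \<otimes> h) = c i x))"

lemma potential_letter:
  assumes "potential V u c" "x \<in> carrier G" "z \<in> plain_alph V"
  shows "\<bar>u (x \<otimes> elt z) - u x\<bar> \<le> 2"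
proof (cases z)
  case (Gen s)
  then have "\<bar>u (x \<otimes> s) - u x\<bar> \<le> 1" using assms by (auto simp: potential_def plain_alph_def)
  then show ?thesis using Gen by simp
next
  case (Per i h)
  then have h: "i \<in> I" "h \<in> H i" "x \<otimes> h \<in> carrier G"
    using assms by (auto simp: plain_alph_def H_closed)
  then have "\<bar>c i x - u x\<bar> \<le> 1" "\<bar>c i (x \<otimes> h) - u (x \<otimes> h)\<bar> \<le> 1" "c i (x \<otimes> h) = c i x"
    using assms(1,2) unfolding potential_def by blast+
  then show ?thesis using Per by simp
qed

lemma potential_path:
  assumes "potential V u c" "V \<subseteq> carrier G" "g \<in> carrier G" "w \<in> lists (plain_alph V)"
  shows "\<bar>u (end_pt g w) - u g\<bar> \<le> 2 * length w"
  using assms(3,4)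
proof (induction w arbitrary: g rule: list.induct)
  case (Cons z w)
  have z: "z \<in> plain_alph V" "w \<in> lists (plain_alph V)" using Cons.prems(2) by auto
  have "g \<otimes> elt z \<in> carrier G" using elt_closed[OF assms(2) z(1)] Cons.prems by simp
  then have "\<bar>u (end_pt (g \<otimes> elt z) w) - u (g \<otimes> elt z)\<bar> \<le> 2 * length w"
    using Cons.IH z by blast
  then show ?case using potential_letter[OF assms(1) Cons.prems(1) z(1)] by simp
qed simp

lemma edge_int_approx:
  assumes "potential V u c" "lipschitz S f" "x \<in> carrier G" "z \<in> plain_alph V" "elt z \<in> S"
  shows "\<bar>edge_int f u c x z - f x * (u (x \<otimes> elt z) - u x)\<bar> \<le> 1"
proof -
  let ?y = "x \<otimes> elt z"
  have f: "\<bar>f ?y - f x\<bar> \<le> 1" using assms by (auto simp: lipschitz_def)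
  show ?thesis
  proof (cases z)
    case (Gen s)
    then have "\<bar>u ?y - u x\<bar> \<le> 1" using assms by (auto simp: potential_def plain_alph_def)
    then have "\<bar>f ?y - f x\<bar> * \<bar>u ?y - u x\<bar> \<le> 1 * 1" using f by (intro mult_mono) auto
    moreover have "edge_int f u c x z - f x * (u ?y - u x) = (f ?y - f x) * (u ?y - u x) / 2"
      using Gen by (simp add: field_simps)
    ultimately show ?thesis by (simp only: abs_divide abs_mult)
  next
    case (Per i h)
    then have h: "i \<in> I" "h \<in> H i" "?y \<in> carrier G"
      using assms by (auto simp: plain_alph_def H_closed)
    have e: "c i ?y = c i x" using assms(1,3) h Per unfolding potential_def by auto
    have "\<bar>u ?y - c i ?y\<bar> \<le> 1"
      using assms(1) h unfolding potential_def by (simp add: abs_minus_commute)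
    then have "\<bar>f ?y - f x\<bar> * \<bar>u ?y - c i ?y\<bar> \<le> 1 * 1" using f by (intro mult_mono) auto
    moreover have "edge_int f u c x z - f x * (u ?y - u x) = (f ?y - f x) * (u ?y - c i ?y)"
      using Per e by (simp add: algebra_simps)
    ultimately show ?thesis by (simp add: abs_mult)
  qed
qed

text \<open>
  On a short word over \<open>S\<close> the weight \<open>f\<close> is nearly constant, so the integral is nearly \<open>f\<close> times the
  increment of \<open>u\<close>. On a closed word this increment vanishes, and what remains is a bound that depends
  on the length alone.
\<close>

lemma path_int_approx:
  assumes "potential V u c" "lipschitz S f" "V \<subseteq> carrier G" "g \<in> carrier G" "w \<in> lists (plain_alph V)"
    and "elt ` set w \<subseteq> S"
  shows "\<bar>path_int f u c w g - f g * (u (end_pt g w) - u g)\<bar> \<le> 2 * (real (length w))\<^sup>2"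
  using assms(4-6)
proof (induction w arbitrary: g rule: list.induct)
  case (Cons z w)
  let ?g = "g \<otimes> elt z" and ?n = "real (length w)"
  have z: "z \<in> plain_alph V" "w \<in> lists (plain_alph V)" "elt z \<in> S" "elt ` set w \<subseteq> S"
    using Cons.prems by auto
  have g: "?g \<in> carrier G" using elt_closed[OF assms(3) z(1)] Cons.prems by simp
  let ?e = "end_pt ?g w"
  have 1: "\<bar>path_int f u c w ?g - f ?g * (u ?e - u ?g)\<bar> \<le> 2 * ?n\<^sup>2"
    using Cons.IH[OF g z(2,4)] .
  have 2: "\<bar>edge_int f u c g z - f g * (u ?g - u g)\<bar> \<le> 1"
    using edge_int_approx[OF assms(1,2) Cons.prems(1) z(1,3)] .
  have "\<bar>f ?g - f g\<bar> \<le> 1" using assms(2) z(3) Cons.prems(1) by (auto simp: lipschitz_def)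
  then have "\<bar>f ?g - f g\<bar> * \<bar>u ?e - u ?g\<bar> \<le> 1 * (2 * ?n)"
    using potential_path[OF assms(1,3) g z(2)] by (intro mult_mono) auto
  then have 3: "\<bar>(f ?g - f g) * (u ?e - u ?g)\<bar> \<le> 2 * ?n" by (simp add: abs_mult)
  have "path_int f u c (z # w) g - f g * (u ?e - u g) =
    (edge_int f u c g z - f g * (u ?g - u g)) + (path_int f u c w ?g - f ?g * (u ?e - u ?g))
      + (f ?g - f g) * (u ?e - u ?g)" by (simp add: algebra_simps)
  moreover have "2 * (real (length (z # w)))\<^sup>2 = 2 * ?n\<^sup>2 + 4 * ?n + 2"
    by (simp add: power2_eq_square algebra_simps)
  ultimately show ?case using 1 2 3 by simp
qed simp

lemma with_system: "is_system G X \<Longrightarrow> peripheral_system G I H X"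
  by (simp add: peripheral_system_def peripheral_system_axioms_def is_group sub)

lemma plain_word_alph:
  "w \<in> lists (alphabet G I H X) \<Longrightarrow> plain_word X w \<in> lists (plain_alph (val X ` letters X))"
  by (induction w) (auto simp: alphabet_def plain_alph_def)

lemma end_pt_plain_word:
  assumes "is_system G X" "w \<in> lists (alphabet G I H X)" "g \<in> carrier G"
  shows "end_pt g (plain_word X w) = g \<otimes> word_val G X w"
  using assms(2,3)
proof (induction w arbitrary: g rule: list.induct)
  case (Cons z w)
  interpret peripheral_system G I H X using assms(1) by (rule with_system)
  have "letter_val X z \<in> carrier G" "word_val G X w \<in> carrier G"
    using Cons.prems letter_val_closed word_val_closed by auto
  then show ?case using Cons by (simp add: word_val_def m_assoc)
qed (simp add: word_val_def)

text \<open>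
  The integral depends only on the element of the free product: a letter and its inverse traverse the same
  edge in both directions, and the two halves at the middle point of a product of peripheral letters cancel.
\<close>

lemma path_int_eqF:
  assumes "is_system G X" "eqF G I H X v w" "g \<in> carrier G"
  shows "path_int f u c (plain_word X v) g = path_int f u c (plain_word X w) g"
proof -
  interpret peripheral_system G I H X using assms(1) by (rule with_system)
  show ?thesis using assms(2,3)
  proof (induction arbitrary: g rule: eqF.induct)
    case (append v v' w w')
    have l: "v \<in> lists (alphabet G I H X)" "v' \<in> lists (alphabet G I H X)"
      using append.hyps eqF_words by blast+
    have "end_pt g (plain_word X v') = end_pt g (plain_word X v)"
      using l word_val_eqF[OF append.hyps(1)] append.prems
      by (simp add: end_pt_plain_word[OF assms(1)])
    moreover have "end_pt g (plain_word X v) \<in> carrier G"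
      using l word_val_closed append.prems by (simp add: end_pt_plain_word[OF assms(1)])
    ultimately show ?case using append by (simp add: path_int_append)
  next
    case (gen x)
    then have "val X x \<in> carrier G" "val X (linv X x) = inv (val X x)"
      using assms(1) by (auto simp: is_system_def)
    then show ?case using gen.prems by (simp add: m_assoc field_simps)
  next
    case (per_mult i h k)
    then have "h \<in> carrier G" "k \<in> carrier G" using H_closed by blast+
    then show ?case using per_mult.prems by (simp add: m_assoc algebra_simps)
  next
    case (per_inv i h k)
    then have "h \<in> carrier G" "k \<in> carrier G" using H_closed by blast+
    then show ?case using per_inv by (simp add: m_assoc algebra_simps)
  qed auto
qed

definition conjugates ::
  "('x, 'a) system \<Rightarrow> (('x, 'i, 'a) word \<times> ('x, 'i, 'a) word) list \<Rightarrow> ('x, 'i, 'a) word" where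
  "conjugates X ps = concat (map (\<lambda>(f, r). word_inv G X f @ r @ f) ps)"

lemma conjugates_simps [simp]:
  "conjugates X [] = []"
  "conjugates X ((f, r) # ps) = word_inv G X f @ r @ f @ conjugates X ps"
  "conjugates X (ps @ qs) = conjugates X ps @ conjugates X qs"
  by (simp_all add: conjugates_def)

lemma conjugates_closed:
  assumes "is_system G X" "R \<subseteq> lists (alphabet G I H X)" "set ps \<subseteq> lists (alphabet G I H X) \<times> R"
  shows "conjugates X ps \<in> lists (alphabet G I H X)"
proof -
  interpret peripheral_system G I H X using assms(1) by (rule with_system)
  have "word_inv G X f @ r @ f \<in> lists (alphabet G I H X)" if "(f, r) \<in> set ps" for f r
  proof -
    have "f \<in> lists (alphabet G I H X)" "r \<in> lists (alphabet G I H X)" using that assms by auto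
    then show ?thesis using word_inv_closed[of f] by auto
  qed
  then show ?thesis unfolding conjugates_def by fastforce
qed

lemma (in peripheral_system) inv_cls:
  assumes "w \<in> lists (alphabet G I H X)"
  shows "inv\<^bsub>freeF G I H X\<^esub> (cls G I H X w) = cls G I H X (word_inv G X w)"
proof -
  interpret F: group "freeF G I H X" by (rule group_freeF)
  have w: "word_inv G X w \<in> lists (alphabet G I H X)" using word_inv_closed assms .
  have "cls G I H X (word_inv G X w) \<otimes>\<^bsub>freeF G I H X\<^esub> cls G I H X w = \<one>\<^bsub>freeF G I H X\<^esub>"
    using word_inv_left[OF assms] w assms by (simp add: freeF_mult cls_eq_iff) (simp add: freeF_def cls_eq_iff)
  then show ?thesis using w assms by (intro F.inv_equality) (auto simp: freeF_def)
qed

text \<open>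
  The products of conjugates of relators form a normal subgroup of the free product, because the
  set of relators is closed under inverses. It therefore contains the kernel of \<open>psi\<close>, so the set whose
  least element is the area is not empty, and the area is attained.
\<close>

lemma closed_word_filling:
  assumes P: "rel_presentation G I H X R"
    and w: "w \<in> lists (alphabet G I H X)" "word_val G X w = \<one>"
  shows "\<exists>ps. length ps = area_rel G I H X R w \<and> set ps \<subseteq> lists (alphabet G I H X) \<times> R \<and>
    eqF G I H X w (conjugates X ps)"
proof -
  have X: "is_system G X" and R: "R \<subseteq> lists (alphabet G I H X)"
    and K: "normal_closure (freeF G I H X) (cls G I H X ` R) = kernel (freeF G I H X) G (psi G X)"
    and Rinv: "\<And>r. r \<in> R \<Longrightarrow> word_inv G X r \<in> R"
    using P by (auto simp: rel_presentation_def rel_gen_system_def)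
  interpret peripheral_system G I H X using X by (rule with_system)
  let ?F = "freeF G I H X" and ?A = "lists (alphabet G I H X)" and ?c = "cls G I H X"
  let ?P = "\<lambda>ps. set ps \<subseteq> ?A \<times> R"
  interpret F: group ?F by (rule group_freeF)
  define N where "N = {?c (conjugates X ps) | ps. ?P ps}"
  have carr: "carrier ?F = ?c ` ?A" by (simp add: freeF_def)
  have cc: "conjugates X ps \<in> ?A" if "?P ps" for ps
    using conjugates_closed[OF X R that] .
  have mult: "?c u \<otimes>\<^bsub>?F\<^esub> ?c v = ?c (u @ v)" if "u \<in> ?A" "v \<in> ?A" for u v
    using freeF_mult[OF that] .
  have Aapp: "u @ v \<in> ?A" if "u \<in> ?A" "v \<in> ?A" for u v using that by auto
  have single: "inv\<^bsub>?F\<^esub> (?c u) \<otimes>\<^bsub>?F\<^esub> ?c r \<otimes>\<^bsub>?F\<^esub> ?c u = ?c (conjugates X [(u, r)])"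
    if "u \<in> ?A" "r \<in> R" for u r
  proof -
    have r: "r \<in> ?A" "word_inv G X u \<in> ?A" using that R word_inv_closed by auto
    then have "?c (word_inv G X u) \<otimes>\<^bsub>?F\<^esub> ?c r \<otimes>\<^bsub>?F\<^esub> ?c u = ?c ((word_inv G X u @ r) @ u)"
      using mult[OF r(2,1)] mult[OF Aapp[OF r(2,1)] that(1)] by simp
    then show ?thesis using that inv_cls by simp
  qed
  have cF: "?c u \<in> carrier ?F" if "u \<in> ?A" for u using that by (auto simp: carr)
  \<comment> \<open>Inverting a product of conjugates reverses the order and inverts each relator.\<close>
  have inv_ex: "\<exists>qs. ?P qs \<and> inv\<^bsub>?F\<^esub> (?c (conjugates X ps)) = ?c (conjugates X qs)" if "?P ps" for ps
    using that
  proof (induction ps)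
    case Nil
    have "?c [] = \<one>\<^bsub>?F\<^esub>" by (simp add: freeF_def)
    then show ?case by (intro exI[of _ "[]"]) simp
  next
    case (Cons a ps)
    obtain u r where a: "a = (u, r)" by fastforce
    obtain qs where qs: "?P qs" "inv\<^bsub>?F\<^esub> (?c (conjugates X ps)) = ?c (conjugates X qs)"
      using Cons by auto
    have u: "u \<in> ?A" "r \<in> R" "?P ps" "?P [(u, r)]" "r \<in> ?A" "?P [(u, word_inv G X r)]"
      using Cons.prems a R Rinv by auto
    have "?c (conjugates X (a # ps)) = ?c (conjugates X [(u, r)]) \<otimes>\<^bsub>?F\<^esub> ?c (conjugates X ps)"
      using a mult[OF cc[OF u(4)] cc[OF u(3)]] by simp
    also have "inv\<^bsub>?F\<^esub> \<dots> = inv\<^bsub>?F\<^esub> (?c (conjugates X ps)) \<otimes>\<^bsub>?F\<^esub> inv\<^bsub>?F\<^esub> (?c (conjugates X [(u, r)]))"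
      using F.inv_mult_group[OF cF[OF cc[OF u(4)]] cF[OF cc[OF u(3)]]] .
    also have "inv\<^bsub>?F\<^esub> (?c (conjugates X [(u, r)]))
        = inv\<^bsub>?F\<^esub> (?c u) \<otimes>\<^bsub>?F\<^esub> inv\<^bsub>?F\<^esub> (?c r) \<otimes>\<^bsub>?F\<^esub> ?c u"
      unfolding single[OF u(1,2), symmetric]
      using cF[OF u(1)] cF[OF u(5)] by (simp add: F.inv_mult_group F.m_assoc)
    also have "\<dots> = ?c (conjugates X [(u, word_inv G X r)])"
      using single[OF u(1) Rinv[OF u(2)]] inv_cls[OF u(5)] by simp
    also have "inv\<^bsub>?F\<^esub> (?c (conjugates X ps)) \<otimes>\<^bsub>?F\<^esub> \<dots> = ?c (conjugates X (qs @ [(u, word_inv G X r)]))"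
      using mult[OF cc[OF qs(1)] cc[OF u(6)]] qs by simp
    finally show ?case using qs(1) u by (intro exI[of _ "qs @ [(u, word_inv G X r)]"]) auto
  qed
  \<comment> \<open>Conjugating by \<open>x\<close> appends the inverse of \<open>x\<close> to each conjugating word.\<close>
  have conj_ex: "\<exists>qs. ?P qs \<and> ?c x \<otimes>\<^bsub>?F\<^esub> ?c (conjugates X ps) \<otimes>\<^bsub>?F\<^esub> inv\<^bsub>?F\<^esub> (?c x) = ?c (conjugates X qs)"
    if "?P ps" "x \<in> ?A" for ps x
    using that(1)
  proof (induction ps)
    case Nil
    have "?c [] = \<one>\<^bsub>?F\<^esub>" by (simp add: freeF_def)
    then show ?case using cF[OF that(2)] by (intro exI[of _ "[]"]) simp
  next
    case (Cons a ps)
    obtain u r where a: "a = (u, r)" by fastforce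
    obtain qs where qs: "?P qs"
      "?c x \<otimes>\<^bsub>?F\<^esub> ?c (conjugates X ps) \<otimes>\<^bsub>?F\<^esub> inv\<^bsub>?F\<^esub> (?c x) = ?c (conjugates X qs)"
      using Cons by auto
    have u: "u \<in> ?A" "r \<in> R" "?P ps" "?P [(u, r)]" "r \<in> ?A" "word_inv G X x \<in> ?A"
      using Cons.prems a R word_inv_closed that by auto
    let ?v = "u @ word_inv G X x"
    have v: "?v \<in> ?A" "?P [(?v, r)]" using u by auto
    have cv: "?c ?v = ?c u \<otimes>\<^bsub>?F\<^esub> inv\<^bsub>?F\<^esub> (?c x)" using mult[OF u(1,6)] inv_cls that by simp
    note C = cF[OF that(2)] cF[OF cc[OF u(3)]] cF[OF u(1)] cF[OF u(5)]
    have cancel: "inv\<^bsub>?F\<^esub> (?c x) \<otimes>\<^bsub>?F\<^esub> (?c x \<otimes>\<^bsub>?F\<^esub> b) = b" if "b \<in> carrier ?F" for b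
      using that C(1) by (simp add: F.m_assoc[symmetric])
    have "?c (conjugates X (a # ps)) = ?c (conjugates X [(u, r)]) \<otimes>\<^bsub>?F\<^esub> ?c (conjugates X ps)"
      using a mult[OF cc[OF u(4)] cc[OF u(3)]] by simp
    also have "?c (conjugates X [(u, r)]) = inv\<^bsub>?F\<^esub> (?c u) \<otimes>\<^bsub>?F\<^esub> ?c r \<otimes>\<^bsub>?F\<^esub> ?c u"
      using single u by simp
    finally have "?c x \<otimes>\<^bsub>?F\<^esub> ?c (conjugates X (a # ps)) \<otimes>\<^bsub>?F\<^esub> inv\<^bsub>?F\<^esub> (?c x)
      = (inv\<^bsub>?F\<^esub> (?c ?v) \<otimes>\<^bsub>?F\<^esub> ?c r \<otimes>\<^bsub>?F\<^esub> ?c ?v) \<otimes>\<^bsub>?F\<^esub>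
        (?c x \<otimes>\<^bsub>?F\<^esub> ?c (conjugates X ps) \<otimes>\<^bsub>?F\<^esub> inv\<^bsub>?F\<^esub> (?c x))"
      unfolding cv using C by (simp add: F.inv_mult_group F.m_assoc cancel)
    also have "\<dots> = ?c (conjugates X ((?v, r) # qs))"
      using single[OF v(1) u(2)] qs mult[OF cc[OF v(2)] cc[OF qs(1)]] by simp
    finally show ?case using qs(1) u v by (intro exI[of _ "(?v, r) # qs"]) auto
  qed
  have N_I: "?c (conjugates X ps) \<in> N" if "?P ps" for ps
    unfolding N_def using that by blast
  have N_E: "\<exists>ps. ?P ps \<and> a = ?c (conjugates X ps)" if "a \<in> N" for a
    using that unfolding N_def by blast
  have "subgroup N ?F"
  proof (rule F.subgroupI)
    show "N \<subseteq> carrier ?F"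
    proof
      fix a assume "a \<in> N"
      then obtain ps where ps: "?P ps" "a = ?c (conjugates X ps)" using N_E by blast
      show "a \<in> carrier ?F" unfolding ps(2) using cF[OF cc[OF ps(1)]] .
    qed
    have "?c (conjugates X []) \<in> N" by (rule N_I) simp
    then show "N \<noteq> {}" by blast
    show "inv\<^bsub>?F\<^esub> a \<in> N" if aN: "a \<in> N" for a
    proof -
      obtain ps where ps: "?P ps" "a = ?c (conjugates X ps)" using N_E[OF aN] by blast
      obtain qs where qs: "?P qs" "inv\<^bsub>?F\<^esub> (?c (conjugates X ps)) = ?c (conjugates X qs)"
        using inv_ex[OF ps(1)] by blast
      show ?thesis unfolding ps(2) qs(2) using N_I[OF qs(1)] .
    qed
    show "a \<otimes>\<^bsub>?F\<^esub> b \<in> N" if ab: "a \<in> N" "b \<in> N" for a b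
    proof -
      obtain ps where ps: "?P ps" "a = ?c (conjugates X ps)" using N_E[OF ab(1)] by blast
      obtain qs where qs: "?P qs" "b = ?c (conjugates X qs)" using N_E[OF ab(2)] by blast
      have "a \<otimes>\<^bsub>?F\<^esub> b = ?c (conjugates X (ps @ qs))"
        using mult[OF cc[OF ps(1)] cc[OF qs(1)]] ps(2) qs(2) by simp
      moreover have "?P (ps @ qs)" using ps(1) qs(1) by simp
      ultimately show ?thesis using N_I[of "ps @ qs"] by simp
    qed
  qed
  moreover have "x \<otimes>\<^bsub>?F\<^esub> a \<otimes>\<^bsub>?F\<^esub> inv\<^bsub>?F\<^esub> x \<in> N" if xa: "x \<in> carrier ?F" "a \<in> N" for x a
  proof -
    obtain v where v: "v \<in> ?A" "x = ?c v" using xa(1) unfolding carr by blast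
    obtain ps where ps: "?P ps" "a = ?c (conjugates X ps)" using N_E[OF xa(2)] by blast
    obtain qs where qs: "?P qs"
      "?c v \<otimes>\<^bsub>?F\<^esub> ?c (conjugates X ps) \<otimes>\<^bsub>?F\<^esub> inv\<^bsub>?F\<^esub> (?c v) = ?c (conjugates X qs)"
      using conj_ex[OF ps(1) v(1)] by blast
    show ?thesis unfolding v(2) ps(2) qs(2) using N_I[OF qs(1)] .
  qed
  ultimately have "N \<lhd> ?F" by (simp add: F.normal_inv_iff)
  moreover have "?c ` R \<subseteq> N"
  proof
    fix a assume "a \<in> ?c ` R"
    then obtain r where "r \<in> R" "a = ?c r" by auto
    then show "a \<in> N" using N_I[of "[([], r)]"] by (simp add: word_inv_def)
  qed
  ultimately have "kernel ?F G (psi G X) \<subseteq> N" unfolding K[symmetric] normal_closure_def by blast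
  moreover have "?c w \<in> kernel ?F G (psi G X)"
    using w cF psi_cls by (simp add: kernel_def)
  ultimately obtain ps where ps: "?P ps" "?c w = ?c (conjugates X ps)" using N_E by blast
  have "eqF G I H X w (conjugates X ps)" using cls_eq_iff[OF cc[OF ps(1)]] ps(2) by blast
  then have "\<exists>k ps. length ps = k \<and> set ps \<subseteq> ?A \<times> R \<and> eqF G I H X w (conjugates X ps)"
    using ps by blast
  from LeastI_ex[OF this] show ?thesis unfolding area_rel_def conjugates_def .
qed

lemma relator_val:
  assumes "rel_presentation G I H X R" "r \<in> R"
  shows "word_val G X r = \<one>"
proof -
  interpret peripheral_system G I H X
    using assms(1) by (intro with_system) (simp add: rel_presentation_def rel_gen_system_def)
  have "cls G I H X r \<in> kernel (freeF G I H X) G (psi G X)"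
    using assms unfolding rel_presentation_def normal_closure_def by blast
  moreover have "r \<in> lists (alphabet G I H X)"
    using assms unfolding rel_presentation_def by blast
  ultimately show ?thesis using psi_cls[of r] by (simp add: kernel_def)
qed

text \<open>
  The conjugating words contribute nothing: a relator returns to its start, so a word and its inverse
  traverse the same path in opposite directions.
\<close>

lemma filling_path_int:
  assumes X: "is_system G X" and P: "rel_presentation G I H X R"
    and ps: "set ps \<subseteq> lists (alphabet G I H X) \<times> R" and g: "g \<in> carrier G"
    and B: "\<And>x r. x \<in> carrier G \<Longrightarrow> r \<in> R \<Longrightarrow> \<bar>path_int f u c (plain_word X r) x\<bar> \<le> B"
  shows "\<bar>path_int f u c (plain_word X (conjugates X ps)) g\<bar> \<le> real (length ps) * B"
proof -
  interpret peripheral_system G I H X using X by (rule with_system)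
  let ?A = "lists (alphabet G I H X)"
  have R: "R \<subseteq> ?A" using P by (simp add: rel_presentation_def)
  note r1 = relator_val[OF P]
  have one: "\<bar>path_int f u c (plain_word X (word_inv G X v @ r @ v)) g\<bar> \<le> B \<and>
    end_pt g (plain_word X (word_inv G X v @ r @ v)) = g" if v: "v \<in> ?A" "r \<in> R" for v r
  proof -
    let ?v = "word_inv G X v"
    let ?h = "end_pt g (plain_word X ?v)"
    have l: "?v \<in> ?A" "r \<in> ?A" using word_inv_closed v R by auto
    have h: "?h \<in> carrier G" using l word_val_closed g by (simp add: end_pt_plain_word[OF X])
    have "end_pt ?h (plain_word X r) = ?h"
      using h l r1[OF v(2)] by (simp add: end_pt_plain_word[OF X])
    moreover have "path_int f u c (plain_word X (?v @ v)) g = path_int f u c (plain_word X []) g"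
      using path_int_eqF[OF X word_inv_left[OF v(1)] g] .
    moreover have "end_pt g (plain_word X (?v @ v)) = end_pt g (plain_word X [])"
      using end_pt_plain_word[OF X _ g, of "?v @ v"] end_pt_plain_word[OF X _ g, of "[]"]
        word_val_eqF[OF word_inv_left[OF v(1)]] v l by simp
    ultimately show ?thesis using B[OF h v(2)] by (simp add: path_int_append)
  qed
  show ?thesis using ps
  proof (induction ps)
    case (Cons a ps)
    obtain v r where a: "a = (v, r)" by fastforce
    then have "v \<in> ?A" "r \<in> R" using Cons.prems by auto
    from one[OF this] Cons show ?case
      unfolding a by (auto simp: path_int_append algebra_simps)
  qed simp
qed

lemma generating_words:
  assumes "rel_gen_system G I H X" "g \<in> carrier G"
  shows "\<exists>w\<in>lists (alphabet G I H X). word_val G X w = g"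
proof -
  interpret peripheral_system G I H X
    using assms(1) by (intro with_system) (simp add: rel_gen_system_def)
  have "g \<in> psi G X ` cls G I H X ` lists (alphabet G I H X)"
    using assms by (simp add: rel_gen_system_def freeF_def)
  then obtain w where "w \<in> lists (alphabet G I H X)" "g = psi G X (cls G I H X w)" by blast
  then show ?thesis using psi_cls by metis
qed

definition filling_ineq :: "'a set \<Rightarrow> 'a set \<Rightarrow> real \<Rightarrow> bool" where
  "filling_ineq V S C \<longleftrightarrow>
    (\<forall>f u c g. \<forall>w\<in>lists (plain_alph V). lipschitz S f \<longrightarrow> potential V u c \<longrightarrow> g \<in> carrier G \<longrightarrow> end_pt g w = g \<longrightarrow>
       \<bar>path_int f u c w g\<bar> \<le> C * real (length w))"

text \<open>
  A closed word over a larger finite set \<open>V\<close> is first rewritten over \<open>X\<close>, replacing each \<open>s\<close> in \<open>V\<close> by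
  a word \<open>W s\<close> over \<open>X\<close> with the same value. This multiplies the length by a constant and changes the integral
  by a constant for each letter. For the empty word the integral is \<open>0\<close>; for the others the constant
  term \<open>b\<close> is absorbed into the linear one. The set \<open>S\<close> collects \<open>V\<close> and all values of letters that
  occur in relators and in the words \<open>W s\<close>.
\<close>

lemma linear_filling:
  assumes fin: "finite (letters X)" "finite R" and P: "rel_presentation G I H X R"
    and wd: "rel_dehn_well_defined G I H X R"
    and lin: "\<And>n. real (rel_dehn G I H X R n) \<le> a * real n + b"
    and V: "finite V" "V \<subseteq> carrier G" "val X ` letters X \<subseteq> V"
  shows "\<exists>S C. finite S \<and> S \<subseteq> elt ` plain_alph V \<and> C \<ge> 0 \<and> filling_ineq V S C"
proof -
  let ?A = "lists (alphabet G I H X)"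
  have gs: "rel_gen_system G I H X" and X: "is_system G X" and R: "R \<subseteq> ?A"
    using P by (auto simp: rel_presentation_def rel_gen_system_def)
  interpret peripheral_system G I H X using X by (rule with_system)
  have plainV: "plain_word X w \<in> lists (plain_alph V)" if "w \<in> ?A" for w
    using plain_word_alph[OF that] plain_alph_mono[OF V(3)] lists_mono by blast
  have "\<forall>s\<in>V. \<exists>w\<in>?A. word_val G X w = s" using generating_words[OF gs] V(2) by blast
  then obtain W where W: "\<And>s. s \<in> V \<Longrightarrow> W s \<in> ?A" "\<And>s. s \<in> V \<Longrightarrow> word_val G X (W s) = s"
    by metis
  define S where "S = V \<union> elt ` (\<Union>w\<in>R \<union> W ` V. set (plain_word X w))"
  have finS: "finite S" unfolding S_def using fin V by auto
  have "V \<subseteq> elt ` plain_alph V" by (force simp: plain_alph_def)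
  moreover have "set (plain_word X w) \<subseteq> plain_alph V" if "w \<in> R \<union> W ` V" for w
    using plainV[of w] that R W by auto
  ultimately have SV: "S \<subseteq> elt ` plain_alph V" unfolding S_def by blast
  define M where "M = Max (insert 0 (length ` (R \<union> W ` V)))"
  have M: "length w \<le> M" if "w \<in> R \<union> W ` V" for w
    unfolding M_def using that fin V by (intro Max_ge) auto
  define B where "B = 2 * (real M)\<^sup>2"
  define subst where "subst = (\<lambda>z. case z of Gen s \<Rightarrow> W s | Per i h \<Rightarrow> [Per i h])"
  have subst: "subst z \<in> ?A" "length (subst z) \<le> M + 1" "word_val G X (subst z) = elt z"
    if z: "z \<in> plain_alph V" for z
  proof -
    have "subst z \<in> ?A \<and> length (subst z) \<le> M + 1 \<and> word_val G X (subst z) = elt z"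
    proof (cases z)
      case (Gen s)
      then have "s \<in> V" using z by (auto simp: plain_alph_def)
      then show ?thesis using Gen W M[of "W s"] by (simp add: subst_def le_SucI)
    next
      case (Per i h)
      then show ?thesis using z by (auto simp: subst_def plain_alph_def alphabet_def word_val_def H_closed)
    qed
    then show "subst z \<in> ?A" "length (subst z) \<le> M + 1" "word_val G X (subst z) = elt z" by auto
  qed
  \<comment> \<open>One letter costs at most \<open>B + 1\<close> when it is rewritten; each relator of the filling costs at most \<open>B\<close>.\<close>
  define C where "C = B + 2 + (\<bar>a\<bar> * real (M + 1) + \<bar>b\<bar>) * B"
  have B0: "B \<ge> 0" by (simp add: B_def)
  have bound: "\<bar>path_int f u c w g\<bar> \<le> C * real (length w)"
    if f: "lipschitz S f" and u: "potential V u c" and g: "g \<in> carrier G" and w: "w \<in> lists (plain_alph V)"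
      and closed: "end_pt g w = g" for f u c g w
  proof -
    have short: "\<bar>path_int f u c (plain_word X v) x - f x * (u (end_pt x (plain_word X v)) - u x)\<bar> \<le> B"
      if "v \<in> R \<union> W ` V" "x \<in> carrier G" for v x
    proof -
      have v: "v \<in> ?A" using that R W by auto
      have "elt ` set (plain_word X v) \<subseteq> S" using that unfolding S_def by blast
      from path_int_approx[OF u f V(2) that(2) plainV[OF v] this]
      have "\<bar>path_int f u c (plain_word X v) x - f x * (u (end_pt x (plain_word X v)) - u x)\<bar>
        \<le> 2 * (real (length v))\<^sup>2" by simp
      also have "\<dots> \<le> B" unfolding B_def using M[OF that(1)] by (simp add: power_mono)
      finally show ?thesis .
    qed
    have letter: "\<bar>edge_int f u c x z - path_int f u c (plain_word X (subst z)) x\<bar> \<le> B + 1"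
      if z: "z \<in> plain_alph V" and x: "x \<in> carrier G" for z x
    proof (cases z)
      case (Gen s)
      then have s: "s \<in> V" using z by (auto simp: plain_alph_def)
      have "end_pt x (plain_word X (W s)) = x \<otimes> s"
        using end_pt_plain_word[OF X W(1)[OF s] x] W(2)[OF s] by simp
      then have "\<bar>path_int f u c (plain_word X (W s)) x - f x * (u (x \<otimes> s) - u x)\<bar> \<le> B"
        using short[of "W s" x] s x by simp
      moreover have "\<bar>edge_int f u c x z - f x * (u (x \<otimes> elt z) - u x)\<bar> \<le> 1"
        using edge_int_approx[OF u f x z] s Gen by (simp add: S_def)
      ultimately show ?thesis using Gen by (simp add: subst_def)
    next
      case (Per i h)
      then show ?thesis using B0 by (simp add: subst_def)
    qed
    let ?s = "\<lambda>w. concat (map subst w)"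
    have replace: "?s v \<in> ?A \<and> length (?s v) \<le> (M + 1) * length v \<and>
      end_pt x (plain_word X (?s v)) = end_pt x v \<and>
      \<bar>path_int f u c v x - path_int f u c (plain_word X (?s v)) x\<bar> \<le> (B + 1) * length v"
      if "v \<in> lists (plain_alph V)" "x \<in> carrier G" for v x
      using that
    proof (induction v arbitrary: x rule: list.induct)
      case (Cons z v)
      have z: "z \<in> plain_alph V" "v \<in> lists (plain_alph V)" using Cons.prems by auto
      let ?x = "x \<otimes> elt z"
      have x: "?x \<in> carrier G" using elt_closed[OF V(2) z(1)] Cons.prems by simp
      have e: "end_pt x (plain_word X (subst z)) = ?x"
        using subst[OF z(1)] Cons.prems by (simp add: end_pt_plain_word[OF X])
      show ?case
        using Cons.IH[OF z(2) x] subst[OF z(1)] letter[OF z(1) Cons.prems(2)] e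
        by (auto simp: path_int_append algebra_simps)
    qed simp
    define v where "v = ?s w"
    note r = replace[OF w g, unfolded closed, folded v_def]
    note v = conjunct1[OF r] r[THEN conjunct2, THEN conjunct1]
      r[THEN conjunct2, THEN conjunct2, THEN conjunct1]
      r[THEN conjunct2, THEN conjunct2, THEN conjunct2]
    have "g \<otimes> word_val G X v = g" using v(3) end_pt_plain_word[OF X v(1) g] by simp
    then have v1: "word_val G X v = \<one>" using word_val_closed[OF v(1)] g by simp
    obtain ps where ps: "length ps = area_rel G I H X R v" "set ps \<subseteq> ?A \<times> R"
      "eqF G I H X v (conjugates X ps)"
      using closed_word_filling[OF P v(1) v1] by blast
    have Rb: "\<bar>path_int f u c (plain_word X r) x\<bar> \<le> B" if xr: "x \<in> carrier G" "r \<in> R" for x r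
    proof -
      have "word_val G X r = \<one>" using relator_val[OF P xr(2)] .
      then have "end_pt x (plain_word X r) = x"
        using end_pt_plain_word[OF X subsetD[OF R xr(2)] xr(1)] xr(1) by simp
      then show ?thesis using short[of r x] xr by simp
    qed
    have "path_int f u c (plain_word X v) g = path_int f u c (plain_word X (conjugates X ps)) g"
      using path_int_eqF[OF X ps(3) g] .
    then have 1: "\<bar>path_int f u c (plain_word X v) g\<bar> \<le> real (length ps) * B"
      using filling_path_int[OF X P ps(2) g Rb] by simp
    let ?n = "(M + 1) * length w"
    have "area_rel G I H X R v \<in> dehn_areas G I H X R ?n"
      unfolding dehn_areas_def using v(1,2) v1 by (intro CollectI exI[of _ v]) simp
    then have "area_rel G I H X R v \<le> rel_dehn G I H X R ?n"
      unfolding rel_dehn_def using wd by (intro Max_ge) (simp_all add: rel_dehn_well_defined_def)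
    then have area: "real (length ps) \<le> a * real ?n + b"
      unfolding ps(1) using lin[of ?n] of_nat_mono order_trans by blast
    show ?thesis
    proof (cases "w = []")
      case False
      define N where "N = real (length w)"
      have n: "N \<ge> 1" using False by (cases w) (auto simp: N_def)
      have rn: "real ?n = real (M + 1) * N" by (simp only: N_def of_nat_mult)
      have "a * real ?n \<le> \<bar>a\<bar> * real ?n" by (rule mult_right_mono) auto
      then have "a * real ?n \<le> \<bar>a\<bar> * real (M + 1) * N" unfolding rn by (simp only: mult.assoc)
      moreover have "b \<le> \<bar>b\<bar> * N" using mult_left_mono[OF n, of "\<bar>b\<bar>"] by simp
      ultimately have "a * real ?n + b \<le> (\<bar>a\<bar> * real (M + 1) + \<bar>b\<bar>) * N"
        unfolding distrib_right by (rule add_mono)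
      then have "real (length ps) \<le> (\<bar>a\<bar> * real (M + 1) + \<bar>b\<bar>) * N"
        using area by (rule order_trans[rotated])
      then have 2: "real (length ps) * B \<le> (\<bar>a\<bar> * real (M + 1) + \<bar>b\<bar>) * N * B"
        using B0 by (rule mult_right_mono)
      have split: "C * N = (B + 1) * N + (\<bar>a\<bar> * real (M + 1) + \<bar>b\<bar>) * N * B + N"
        unfolding C_def by (simp only: ring_distribs mult_ac)
      have "\<bar>p\<bar> \<le> t" if "t = x + z + N" "\<bar>p - q\<bar> \<le> x" "\<bar>q\<bar> \<le> y" "y \<le> z"
        for p q t x y z :: real using that n by linarith
      from this[OF split v(4)[folded N_def] 1 2]
      have "\<bar>path_int f u c w g\<bar> \<le> C * N" .
      then show ?thesis unfolding N_def .
    qed simp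
  qed
  have "C \<ge> 0" unfolding C_def using B0 by simp
  then show ?thesis unfolding filling_ineq_def
    by (intro exI[of _ S] exI[of _ C] conjI allI ballI impI finS SV bound)
qed

section \<open>Cutting a geodesic\<close>

text \<open>
  The potential used to cut a geodesic that starts in \<open>v\<close>: the distance from \<open>v\<close>, truncated
  to the range from \<open>lo\<close> to \<open>hi\<close>. A cone point gets the maximum over its coset, and this choice matters:
  the jump of the potential along a peripheral edge of the geodesic is then concentrated on the half at the
  initial vertex, so the integral sees the value of \<open>f\<close> there.
\<close>

definition level :: "'a set \<Rightarrow> 'a \<Rightarrow> nat \<Rightarrow> nat \<Rightarrow> 'a \<Rightarrow> nat" where
  "level V v lo hi x = max lo (min hi (rdist V v x))"

definition cone_level :: "'a set \<Rightarrow> 'a \<Rightarrow> nat \<Rightarrow> nat \<Rightarrow> 'i \<Rightarrow> 'a \<Rightarrow> nat" where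
  "cone_level V v lo hi i x = Max ((\<lambda>h. level V v lo hi (x \<otimes> h)) ` H i)"

lemma finite_levels: "finite ((\<lambda>h. level V v lo hi (x \<otimes> h)) ` A)"
  by (rule finite_subset[of _ "{..max lo hi}"]) (auto simp: level_def)

lemma cone_level_ge: "i \<in> I \<Longrightarrow> h \<in> H i \<Longrightarrow> level V v lo hi (x \<otimes> h) \<le> cone_level V v lo hi i x"
  unfolding cone_level_def by (rule Max_ge[OF finite_levels]) simp

lemma cone_level_le:
  assumes "i \<in> I" "\<And>h. h \<in> H i \<Longrightarrow> level V v lo hi (x \<otimes> h) \<le> k"
  shows "cone_level V v lo hi i x \<le> k"
proof -
  have "H i \<noteq> {}" using subgroup.one_closed[OF sub[OF assms(1)]] by auto
  then show ?thesis unfolding cone_level_def using assms(2) finite_levels by simp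
qed

lemma level_le_cone_level:
  assumes "i \<in> I" "x \<in> carrier G"
  shows "level V v lo hi x \<le> cone_level V v lo hi i x"
  using cone_level_ge[OF assms(1) subgroup.one_closed[OF sub[OF assms(1)]], of V v lo hi x] assms(2)
  by simp

lemma cone_level_shift:
  assumes "i \<in> I" "h \<in> H i" "x \<in> carrier G"
  shows "cone_level V v lo hi i (x \<otimes> h) = cone_level V v lo hi i x"
proof (rule order_antisym)
  have h: "h \<in> carrier G" "inv h \<in> H i" using assms H_closed subgroup.m_inv_closed[OF sub] by auto
  have k: "h \<otimes> k \<in> H i" "inv h \<otimes> k \<in> H i" "k \<in> carrier G" if "k \<in> H i" for k
    using that assms h H_closed subgroup.m_closed[OF sub[OF assms(1)]] by auto
  show "cone_level V v lo hi i (x \<otimes> h) \<le> cone_level V v lo hi i x"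
    using cone_level_ge[OF assms(1) k(1)] k(3) h assms(3) by (intro cone_level_le assms(1)) (simp add: m_assoc)
  show "cone_level V v lo hi i x \<le> cone_level V v lo hi i (x \<otimes> h)"
  proof (intro cone_level_le assms(1))
    fix l assume l: "l \<in> H i"
    have "x \<otimes> h \<otimes> (inv h \<otimes> l) = x \<otimes> l"
      using k(3)[OF l] h(1) assms(3) by (simp add: m_assoc flip: m_assoc[of h "inv h" l])
    then show "level V v lo hi (x \<otimes> l) \<le> cone_level V v lo hi i (x \<otimes> h)"
      using cone_level_ge[OF assms(1) k(2)[OF l], of V v lo hi "x \<otimes> h"] by simp
  qed
qed

lemma level_step:
  assumes "rel_gen_set V" "v \<in> carrier G" "x \<in> carrier G" "y \<in> carrier G" "rdist V x y \<le> 1"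
  shows "level V v lo hi y \<le> level V v lo hi x + 1"
  using rdist_triangle[OF assms(1-4)] assms(5) unfolding level_def by linarith

lemma potential_level:
  assumes V: "rel_gen_set V" and v: "v \<in> carrier G"
  shows "potential V (\<lambda>x. real (level V v lo hi x)) (\<lambda>i x. real (cone_level V v lo hi i x))"
proof -
  have VG: "V \<subseteq> carrier G" using V by (simp add: rel_gen_set_def)
  have both: "level V v lo hi y \<le> level V v lo hi x + 1 \<and> level V v lo hi x \<le> level V v lo hi y + 1"
    if "x \<in> carrier G" "y \<in> carrier G" "rdist V x y \<le> 1" for x y
    using level_step[OF V v that] level_step[OF V v that(2,1)] that rdist_sym[OF V that(1,2)] by simp
  show ?thesis unfolding potential_def
  proof (intro conjI ballI)
    fix x s assume x: "x \<in> carrier G" and s: "s \<in> V"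
    have "rdist V x (x \<otimes> s) \<le> 1" using rdist_step[of "Gen s" V x] s by (simp add: plain_alph_def)
    then show "\<bar>real (level V v lo hi (x \<otimes> s)) - real (level V v lo hi x)\<bar> \<le> 1"
      using both[OF x m_closed[OF x subsetD[OF VG s]]] by linarith
  next
    fix i x assume i: "i \<in> I" and x: "x \<in> carrier G"
    have "cone_level V v lo hi i x \<le> level V v lo hi x + 1"
    proof (intro cone_level_le i)
      fix h assume h: "h \<in> H i"
      show "level V v lo hi (x \<otimes> h) \<le> level V v lo hi x + 1"
        using both[of x "x \<otimes> h"] rdist_coset[OF i h x] H_closed[OF i h] x by simp
    qed
    then show "\<bar>real (cone_level V v lo hi i x) - real (level V v lo hi x)\<bar> \<le> 1"
      using level_le_cone_level[OF i x, of V v lo hi] by simp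
  next
    fix i x h assume "i \<in> I" "x \<in> carrier G" "h \<in> H i"
    then show "real (cone_level V v lo hi i (x \<otimes> h)) = real (cone_level V v lo hi i x)"
      using cone_level_shift by simp
  qed
qed

text \<open>
  On an edge of the geodesic the potential increases by \<open>1\<close> within the range and is constant outside. The
  cone point has the level of the terminal vertex, since no point of the coset is farther from \<open>v\<close>. The
  factor \<open>1/2\<close> is due to edges in \<open>V\<close>, where half of the weight belongs to the terminal vertex.
\<close>

lemma edge_int_geodesic:
  assumes V: "rel_gen_set V" and v: "v \<in> carrier G" and x: "x \<in> carrier G" and z: "z \<in> plain_alph V"
    and d: "rdist V v x = j" "rdist V v (x \<otimes> elt z) = j + 1"
    and f: "f x \<ge> 0" "f (x \<otimes> elt z) \<ge> 0" and "lo \<le> hi"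
  shows "(if lo \<le> j \<and> j < hi then f x / 2 else 0) \<le>
    edge_int f (\<lambda>x. real (level V v lo hi x)) (\<lambda>i x. real (cone_level V v lo hi i x)) x z"
proof -
  let ?y = "x \<otimes> elt z" and ?u = "level V v lo hi" and ?c = "cone_level V v lo hi"
  have y: "?y \<in> carrier G" using V elt_closed[OF _ z] x by (simp add: rel_gen_set_def)
  have u: "?u ?y = ?u x + (if lo \<le> j \<and> j < hi then 1 else 0)"
    using d assms(9) unfolding level_def by auto
  show ?thesis
  proof (cases z)
    case (Gen s)
    then show ?thesis using u f by auto
  next
    case (Per i h)
    then have h: "i \<in> I" "h \<in> H i" using z by (auto simp: plain_alph_def)
    have "?c i x \<le> ?u ?y"
    proof (intro cone_level_le h(1))
      fix k assume k: "k \<in> H i"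
      have "rdist V v (x \<otimes> k) \<le> rdist V v x + rdist V x (x \<otimes> k)"
        using rdist_triangle[OF V v x] H_closed[OF h(1) k] x by simp
      also have "\<dots> \<le> rdist V v ?y" using rdist_coset[OF h(1) k x, of V] d by simp
      finally show "?u (x \<otimes> k) \<le> ?u ?y" unfolding level_def by linarith
    qed
    moreover have "?u ?y \<le> ?c i x" using cone_level_ge[OF h, of V v lo hi x] Per by simp
    moreover have "?c i ?y = ?c i x" using cone_level_shift[OF h x] Per by simp
    ultimately have "?c i x = ?u ?y" "?c i ?y = ?u ?y" by simp_all
    then show ?thesis using Per u f by auto
  qed
qed

text \<open>
  This holds for the vertex set of a quasi-geodesic, with the constant of the quasi-geodesic.
\<close>

definition quasi_convex :: "'a set \<Rightarrow> nat \<Rightarrow> 'a set \<Rightarrow> bool" where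
  "quasi_convex V lam Q \<longleftrightarrow> Q \<subseteq> carrier G \<and> (\<forall>x\<in>Q. \<forall>y\<in>Q. \<exists>w\<in>lists (plain_alph V).
     end_pt x w = y \<and> set (path_verts w x) \<subseteq> Q \<and> length w \<le> lam * rdist V x y)"

lemma filling_two_paths:
  assumes V: "rel_gen_set V" and fill: "filling_ineq V S C" and f: "lipschitz S f" and u: "potential V u c"
    and g: "g \<in> carrier G" and P: "P \<in> lists (plain_alph V)" and Q: "Q \<in> lists (plain_alph V)"
    and e: "end_pt g P = end_pt g Q"
  shows "\<bar>path_int f u c P g - path_int f u c Q g\<bar> \<le> C * real (length P + length Q)"
proof -
  have "V \<subseteq> carrier G" "\<forall>s\<in>V. inv s \<in> V" using V by (auto simp: rel_gen_set_def)
  from reverse_path[OF this g Q] obtain Q' where Q': "Q' \<in> lists (plain_alph V)" "length Q' = length Q"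
    "end_pt (end_pt g Q) Q' = g" "path_int f u c Q' (end_pt g Q) = - path_int f u c Q g" by blast
  have l: "P @ Q' \<in> lists (plain_alph V)" using P Q'(1) by simp
  have "\<bar>path_int f u c (P @ Q') g\<bar> \<le> C * real (length (P @ Q'))"
    using fill l f u g Q'(3) e unfolding filling_ineq_def by (metis end_pt_simps(3))
  then show ?thesis using Q' e by (simp add: path_int_append)
qed

text \<open>
  The geodesic is cut at \<open>a\<close> and \<open>b\<close>, which lie \<open>r + 1\<close> before \<open>s\<close> and \<open>r + 1\<close> after \<open>t\<close>, or at its ends if
  these are closer. Paths of length at most \<open>r\<close> lead from there into \<open>Q\<close>, and their feet are joined
  inside \<open>Q\<close>. The integral over this detour is \<open>0\<close>: on the part in \<open>Q\<close> the weight vanishes, and the two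
  short paths are too far from the stretch between \<open>s\<close> and \<open>t\<close> for the truncated potential to vary on
  them. The closed path has length linear in \<open>t - s + r\<close>, so the filling inequality bounds the
  integral along the geodesic.
\<close>

lemma cut_inequality:
  assumes V: "rel_gen_set V" and fill: "filling_ineq V S C" and C: "C \<ge> 0"
    and g: "g \<in> carrier G" and p: "p \<in> lists (plain_alph V)" "length p = rdist V g (end_pt g p)"
    and Q: "quasi_convex V lam Q" "g \<in> Q" "end_pt g p \<in> Q"
    and near: "\<And>j. j \<le> length p \<Longrightarrow> \<exists>x\<in>Q. rdist V (end_pt g (take j p)) x \<le> r"
    and f: "lipschitz S f" "\<And>x. f x \<ge> 0" "\<And>x. x \<in> Q \<Longrightarrow> f x = 0"
    and st: "s \<le> t" "t \<le> length p"
  shows "(\<Sum>j=s..<t. f (end_pt g (take j p))) \<le> 8 * real (lam + 1) * C * real (t - s + r + 1)"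
proof -
  define pt where "pt = (\<lambda>j. end_pt g (take j p))"
  define m where "m = length p"
  define a where "a = s - (r + 1)"
  define b where "b = min m (t + r + 1)"
  have ab: "a \<le> s" "t \<le> b" "a \<le> b" "b \<le> m" "b - a \<le> t - s + 2 * r + 2"
    using st unfolding a_def b_def m_def by auto
  have VG: "V \<subseteq> carrier G" using V by (simp add: rel_gen_set_def)
  have tk: "take j p \<in> lists (plain_alph V)" "drop j p \<in> lists (plain_alph V)" for j
    using p(1) by (auto dest: in_set_takeD in_set_dropD)
  have ptc: "pt j \<in> carrier G" for j unfolding pt_def using end_pt_closed[OF VG g tk(1)] .
  have ptd: "rdist V (pt i) (pt j) = j - i" if "i \<le> j" "j \<le> m" for i j
    unfolding pt_def using rdist_geodesic_verts[OF V g p] that by (simp add: m_def)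
  define P where "P = take (b - a) (drop a p)"
  have P: "P \<in> lists (plain_alph V)" unfolding P_def using tk(2)[of a] by (auto dest: in_set_takeD)
  have lP: "length P = b - a" unfolding P_def using ab by (simp add: m_def)
  have ptP: "end_pt (pt a) (take i P) = pt (a + i)" if "i \<le> b - a" for i
    using that unfolding pt_def P_def by (simp add: take_add flip: end_pt_simps(3))
  have eP: "end_pt (pt a) P = pt b" using ptP[of "b - a"] ab lP by simp
  define u where "u = (\<lambda>x. real (level V (pt a) (s - a) (t - a) x))"
  define c where "c = (\<lambda>i x. real (cone_level V (pt a) (s - a) (t - a) i x))"
  have potential: "potential V u c" unfolding u_def c_def using potential_level[OF V ptc] .
  \<comment> \<open>The integral along the geodesic only sees the part between \<open>s\<close> and \<open>t\<close>.\<close>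
  have low: "(\<Sum>j=s..<t. f (pt j)) / 2 \<le> path_int f u c P (pt a)"
  proof -
    have e: "(if s - a \<le> j \<and> j < t - a then f (pt (j + a)) / 2 else 0)
        \<le> edge_int f u c (end_pt (pt a) (take j P)) (P ! j)" if j: "j < b - a" for j
    proof -
      have z: "P ! j \<in> plain_alph V" using P j lP by (simp add: in_lists_conv_set)
      have "take (Suc j) P = take j P @ [P ! j]" using j lP by (simp add: take_Suc_conv_app_nth)
      then have y: "pt (a + j) \<otimes> elt (P ! j) = pt (a + Suc j)"
        using ptP[of j] ptP[of "Suc j"] j by simp
      have d: "rdist V (pt a) (pt (a + j)) = j" "rdist V (pt a) (pt (a + Suc j)) = j + 1"
        using ptd[of a "a + j"] ptd[of a "a + Suc j"] j ab by auto
      have "s - a \<le> t - a" using st by simp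
      from edge_int_geodesic[where f = f, OF V ptc ptc z d(1) d(2)[folded y] f(2) f(2) this]
      show ?thesis unfolding u_def c_def ptP[OF less_imp_le[OF j]] add.commute[of j a] .
    qed
    have "(\<Sum>j=s..<t. f (pt j)) / 2 = (\<Sum>j=s..<t. f (pt j) / 2)" by (rule sum_divide_distrib)
    also have "\<dots> = (\<Sum>j=s-a..<t-a. f (pt (j + a)) / 2)"
      using sum.shift_bounds_nat_ivl[of "\<lambda>j. f (pt j) / 2" "s - a" a "t - a"] ab st by simp
    also have "\<dots> = (\<Sum>j\<in>{..<b - a}. if s - a \<le> j \<and> j < t - a then f (pt (j + a)) / 2 else 0)"
      using ab by (intro sum.mono_neutral_cong_left) auto
    also have "\<dots> \<le> (\<Sum>j<b - a. edge_int f u c (end_pt (pt a) (take j P)) (P ! j))"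
      using e by (intro sum_mono) simp
    also have "\<dots> = path_int f u c P (pt a)" by (simp add: path_int_sum lP)
    finally show ?thesis .
  qed
  obtain w1 v1 where w1: "w1 \<in> Q" "v1 \<in> lists (plain_alph V)" "end_pt (pt a) v1 = w1"
    "length v1 \<le> r" "path_int f u c v1 (pt a) = 0"
  proof (cases "a = 0")
    case True
    then show ?thesis using that[of g "[]"] Q(2) by (simp add: pt_def)
  next
    case False
    obtain w where w: "w \<in> Q" "rdist V (pt a) w \<le> r"
      using near[of a] ab unfolding pt_def m_def by auto
    have wc: "w \<in> carrier G" using w Q(1) by (auto simp: quasi_convex_def)
    obtain v where v: "v \<in> lists (plain_alph V)" "length v = rdist V (pt a) w" "end_pt (pt a) v = w"
      using rdist_attained[OF V ptc wc] .
    \<comment> \<open>The path stays within distance \<open>r\<close> of its start, and the cosets that it meets within \<open>r + 1\<close>,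
        so points and cone points have the minimal level.\<close>
    have sa: "s - a = r + 1" using False unfolding a_def by simp
    have "u x = s - a \<and> (\<forall>i\<in>I. c i x = s - a)" if x: "x \<in> set (path_verts v (pt a))" for x
    proof -
      have xc: "x \<in> carrier G" using path_verts_closed[OF VG ptc v(1)] x by auto
      have d: "rdist V (pt a) x \<le> r" using rdist_path_verts(1)[OF x v(1)] v w by simp
      then have l: "level V (pt a) (s - a) (t - a) x = s - a"
        using sa st unfolding level_def by simp
      have "cone_level V (pt a) (s - a) (t - a) i x = s - a" if i: "i \<in> I" for i
      proof (rule order_antisym)
        show "cone_level V (pt a) (s - a) (t - a) i x \<le> s - a"
        proof (intro cone_level_le i)
          fix h assume h: "h \<in> H i"
          have "rdist V (pt a) (x \<otimes> h) \<le> rdist V (pt a) x + rdist V x (x \<otimes> h)"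
            using rdist_triangle[OF V ptc xc] H_closed[OF i h] xc by simp
          also have "\<dots> \<le> s - a" using rdist_coset[OF i h xc, of V] d sa by simp
          finally show "level V (pt a) (s - a) (t - a) (x \<otimes> h) \<le> s - a"
            unfolding level_def by simp
        qed
      qed (use level_le_cone_level[OF i xc, of V "pt a" "s - a" "t - a"] l in simp)
      then show ?thesis using l by (simp add: u_def c_def)
    qed
    then have "path_int f u c v (pt a) = 0" by (rule path_int_flat[OF v(1)])
    then show ?thesis using that v w by auto
  qed
  obtain w2 v2 where w2: "w2 \<in> Q" "v2 \<in> lists (plain_alph V)" "end_pt w2 v2 = pt b"
    "length v2 \<le> r" "path_int f u c v2 w2 = 0"
  proof (cases "b = m")
    case True
    then show ?thesis using that[of "pt m" "[]"] Q(3) by (simp add: pt_def m_def)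
  next
    case False
    obtain w where w: "w \<in> Q" "rdist V (pt b) w \<le> r"
      using near[of b] ab unfolding pt_def m_def by auto
    have wc: "w \<in> carrier G" using w Q(1) by (auto simp: quasi_convex_def)
    obtain v where v: "v \<in> lists (plain_alph V)" "length v = rdist V w (pt b)" "end_pt w v = pt b"
      using rdist_attained[OF V wc ptc] .
    \<comment> \<open>All points of the path have the maximal level, which is then forced on the cone points.\<close>
    have bt: "b = t + r + 1" using False unfolding b_def by simp
    have "u x = t - a \<and> (\<forall>i\<in>I. c i x = t - a)" if x: "x \<in> set (path_verts v w)" for x
    proof -
      have xc: "x \<in> carrier G" using path_verts_closed[OF VG wc v(1)] x by auto
      have "rdist V x (pt b) \<le> r"
        using rdist_path_verts(2)[OF x v(1)] v w rdist_sym[OF V wc ptc] by simp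
      then have d: "t - a \<le> rdist V (pt a) x"
        using rdist_triangle[OF V ptc xc ptc, of a b] ptd[of a b] ab bt by simp
      then have l: "level V (pt a) (s - a) (t - a) x = t - a"
        using st unfolding level_def by simp
      have "cone_level V (pt a) (s - a) (t - a) i x = t - a" if i: "i \<in> I" for i
      proof (rule order_antisym)
        show "cone_level V (pt a) (s - a) (t - a) i x \<le> t - a"
          using st by (intro cone_level_le i) (simp add: level_def)
      qed (use level_le_cone_level[OF i xc, of V "pt a" "s - a" "t - a"] l in simp)
      then show ?thesis using l by (simp add: u_def c_def)
    qed
    then have "path_int f u c v w = 0" by (rule path_int_flat[OF v(1)])
    then show ?thesis using that v w rdist_sym[OF V wc ptc] by auto
  qed
  obtain q where q: "q \<in> lists (plain_alph V)" "end_pt w1 q = w2" "set (path_verts q w1) \<subseteq> Q"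
    "length q \<le> lam * rdist V w1 w2"
    using Q(1) w1(1) w2(1) unfolding quasi_convex_def by blast
  have q0: "path_int f u c q w1 = 0" using q(3) f(3) by (intro path_int_zero) blast
  let ?D = "v1 @ q @ v2"
  have D: "?D \<in> lists (plain_alph V)" "end_pt (pt a) ?D = pt b" "path_int f u c ?D (pt a) = 0"
    using w1 w2 q q0 by (simp_all add: path_int_append)
  have wc: "w1 \<in> carrier G" "w2 \<in> carrier G" using w1 w2 Q(1) by (auto simp: quasi_convex_def)
  have "rdist V (pt a) w1 \<le> r" "rdist V w2 (pt b) \<le> r"
    using rdist_le[OF w1(2), of "pt a"] w1 rdist_le[OF w2(2), of w2] w2 by auto
  then have "rdist V w1 w2 \<le> 2 * r + (b - a)"
    using rdist_triangle[OF V wc(1) ptc wc(2), of a] rdist_triangle[OF V ptc ptc wc(2), of a b]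
      rdist_sym[OF V wc(1) ptc] rdist_sym[OF V wc(2) ptc] ptd[of a b] ab by simp
  then have "rdist V w1 w2 \<le> t - s + 4 * r + 2" using ab(5) by linarith
  from order_trans[OF q(4) mult_le_mono2[OF this]]
  have "length P + length ?D \<le> (lam + 1) * (t - s + 4 * r + 2)"
    using lP ab(5) w1(4) w2(4) by simp
  also have "\<dots> \<le> (lam + 1) * (4 * (t - s + r + 1))" by (intro mult_le_mono2) simp
  finally have "real (length P + length ?D) \<le> real ((lam + 1) * (4 * (t - s + r + 1)))"
    by (rule of_nat_mono)
  then have len: "real (length P + length ?D) \<le> real (lam + 1) * (4 * real (t - s + r + 1))"
    by (simp only: of_nat_mult of_nat_numeral)
  have "\<bar>path_int f u c P (pt a) - path_int f u c ?D (pt a)\<bar> \<le> C * real (length P + length ?D)"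
    using filling_two_paths[OF V fill f(1) potential ptc P D(1)] eP D(2) by simp
  also have "\<dots> \<le> C * (real (lam + 1) * (4 * real (t - s + r + 1)))"
    using len C by (rule mult_left_mono)
  finally have "path_int f u c P (pt a) \<le> C * (real (lam + 1) * (4 * real (t - s + r + 1)))"
    using D(3) by simp
  with low have "(\<Sum>j=s..<t. f (pt j)) / 2 \<le> C * (real (lam + 1) * (4 * real (t - s + r + 1)))"
    by linarith
  then have "(\<Sum>j=s..<t. f (pt j)) \<le> 2 * (C * (real (lam + 1) * (4 * real (t - s + r + 1))))" by simp
  also have "\<dots> = 8 * real (lam + 1) * C * real (t - s + r + 1)" by (simp only: mult_ac)
  finally show ?thesis unfolding pt_def .
qed

section \<open>Stability of geodesics\<close>

lemma sum_countdown: "(\<Sum>i<r. real (r - i)) = real r * (real r + 1) / 2"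
proof (induction r)
  case (Suc r)
  have "(\<Sum>i<Suc r. real (Suc r - i)) = real (Suc r) + (\<Sum>i<r. real (r - i))"
    by (simp only: sum.lessThan_Suc_shift) simp
  then show ?case using Suc by (simp add: field_simps)
qed simp

text \<open>
  Let \<open>k\<close> be the index of a vertex at the maximal distance \<open>r\<close> from \<open>Q\<close>. The tent of height \<open>r\<close> around it
  vanishes on \<open>Q\<close>. Since the end of the geodesic is in \<open>Q\<close>, at least \<open>r\<close> edges follow this vertex, and the
  sum of the tent over them is \<open>r (r + 1) / 2\<close>. The cut inequality bounds it by a multiple of \<open>r + 1\<close>.
\<close>

lemma geodesic_near_quasi_convex:
  assumes V: "rel_gen_set V" and fill: "filling_ineq V S C" and C: "C \<ge> 0" and S: "S \<subseteq> elt ` plain_alph V"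
    and g: "g \<in> carrier G" and p: "p \<in> lists (plain_alph V)" "length p = rdist V g (end_pt g p)"
    and Q: "quasi_convex V lam Q" "g \<in> Q" "end_pt g p \<in> Q"
    and j: "j \<le> length p"
  shows "\<exists>x\<in>Q. rdist V (end_pt g (take j p)) x \<le> nat \<lceil>32 * real (lam + 1) * C\<rceil>"
proof -
  define pt where "pt = (\<lambda>j. end_pt g (take j p))"
  define e where "e = (\<lambda>j. LEAST n. \<exists>x\<in>Q. rdist V (pt j) x = n)"
  define r where "r = Max (e ` {..length p})"
  have VG: "V \<subseteq> carrier G" using V by (simp add: rel_gen_set_def)
  have QG: "Q \<subseteq> carrier G" using Q by (simp add: quasi_convex_def)
  have tk: "take j p \<in> lists (plain_alph V)" for j using p(1) by (auto dest: in_set_takeD)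
  have ptc: "pt j \<in> carrier G" for j unfolding pt_def using end_pt_closed[OF VG g tk] .
  have e: "\<exists>x\<in>Q. rdist V (pt j) x = e j" for j
    unfolding e_def by (rule LeastI_ex) (use Q(2) in blast)
  have e_le: "e j \<le> rdist V (pt j) x" if "x \<in> Q" for j x
    unfolding e_def by (rule Least_le) (use that in blast)
  have e_r: "e j \<le> r" if "j \<le> length p" for j
    unfolding r_def using that by (intro Max_ge) auto
  have "r \<in> e ` {..length p}" unfolding r_def by (rule Max_in) auto
  then obtain k where k: "k \<le> length p" "e k = r" by auto
  define f where "f = (\<lambda>x. real (r - rdist V (pt k) x))"
  have kr: "k + r \<le> length p"
  proof -
    have "rdist V (pt k) (pt (length p)) = length p - k"
      unfolding pt_def using rdist_geodesic_verts[OF V g p k(1)] by simp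
    then show ?thesis using e_le[of "pt (length p)" k] Q(3) k by (simp add: pt_def)
  qed
  have lipschitz: "lipschitz S f" unfolding lipschitz_def
  proof (intro ballI)
    fix x s assume x: "x \<in> carrier G" and s: "s \<in> S"
    then obtain z where z: "z \<in> plain_alph V" "s = elt z" using S by auto
    have "s \<in> carrier G" using z elt_closed[OF VG] by simp
    then have xs: "x \<otimes> s \<in> carrier G" using x by simp
    have "\<bar>real (rdist V (pt k) x) - real (rdist V (pt k) (x \<otimes> s))\<bar> \<le> 1"
      using rdist_lipschitz[OF x xs ptc V] rdist_step[OF z(1)] z(2) by blast
    then show "\<bar>f (x \<otimes> s) - f x\<bar> \<le> 1" unfolding f_def by linarith
  qed
  have near: "\<exists>x\<in>Q. rdist V (end_pt g (take j p)) x \<le> r" if "j \<le> length p" for j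
  proof -
    obtain x where "x \<in> Q" "rdist V (pt j) x = e j" using e by blast
    then show ?thesis using e_r[OF that] unfolding pt_def by (intro bexI[of _ x]) simp_all
  qed
  have "(\<Sum>j=k..<k+r. f (pt j)) \<le> 8 * real (lam + 1) * C * real (k + r - k + r + 1)"
    unfolding pt_def
  proof (rule cut_inequality[OF V fill C g p Q near lipschitz])
    show "f x = 0" if "x \<in> Q" for x using e_le[OF that, of k] k(2) unfolding f_def by simp
  qed (use kr in \<open>auto simp: f_def\<close>)
  moreover have "(\<Sum>j=k..<k+r. f (pt j)) = (\<Sum>i<r. real (r - i))"
  proof -
    have "(\<Sum>j=k..<k+r. f (pt j)) = (\<Sum>i=0..<r. f (pt (i + k)))"
      using sum.shift_bounds_nat_ivl[of "\<lambda>j. f (pt j)" 0 k r] by (simp add: add.commute)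
    also have "\<dots> = (\<Sum>i=0..<r. real (r - i))"
    proof (rule sum.cong)
      fix i assume "i \<in> {0..<r}"
      then have "rdist V (pt k) (pt (i + k)) = i"
        unfolding pt_def using rdist_geodesic_verts[OF V g p, of k "i + k"] kr by simp
      then show "f (pt (i + k)) = real (r - i)" by (simp add: f_def)
    qed simp
    finally show ?thesis by (simp add: lessThan_atLeast0)
  qed
  moreover have "8 * real (lam + 1) * C * real (k + r - k + r + 1) \<le> 8 * real (lam + 1) * C * (2 * (real r + 1))"
    using C by (intro mult_left_mono) auto
  ultimately have "real r * (real r + 1) / 2 \<le> 8 * real (lam + 1) * C * (2 * (real r + 1))"
    unfolding sum_countdown by linarith
  then have "real r * (real r + 1) \<le> (32 * real (lam + 1) * C) * (real r + 1)"
    by (simp add: field_simps)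
  then have "real r \<le> 32 * real (lam + 1) * C"
    by (rule mult_right_le_imp_le) simp
  then have "r \<le> nat \<lceil>32 * real (lam + 1) * C\<rceil>" by linarith
  then show ?thesis using near[OF j] le_trans by blast
qed

text \<open>
  Balls in the word metric of \<open>S\<close>; for a finite set \<open>S\<close> they are finite, unlike those of the relative metric.
\<close>

primrec gen_ball :: "'a set \<Rightarrow> nat \<Rightarrow> 'a set" where
  "gen_ball S 0 = {\<one>}"
| "gen_ball S (Suc n) = gen_ball S n \<union> {x \<otimes> s | x s. x \<in> gen_ball S n \<and> s \<in> S}"

lemma gen_ball_closed: "S \<subseteq> carrier G \<Longrightarrow> gen_ball S n \<subseteq> carrier G"
  by (induction n) auto

lemma finite_gen_ball: "finite S \<Longrightarrow> finite (gen_ball S n)"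
proof (induction n)
  case (Suc n)
  have "{x \<otimes> s | x s. x \<in> gen_ball S n \<and> s \<in> S} = (\<lambda>(x, s). x \<otimes> s) ` (gen_ball S n \<times> S)" by auto
  then show ?case using Suc by simp
qed simp

lemma one_gen_ball: "\<one> \<in> gen_ball S n"
  by (induction n) auto

text \<open>
  Counting the \<open>n < R\<close> for which \<open>x\<close> is in the ball of radius \<open>n\<close> around \<open>v\<close> gives a tent of height \<open>R\<close>
  that also makes sense where the word metric is infinite; the lemma is its Lipschitz condition.
\<close>

lemma gen_ball_index_step:
  assumes S: "S \<subseteq> carrier G" and s: "s \<in> S" and x: "x \<in> carrier G" and v: "v \<in> carrier G"
  shows "card {n. n < R \<and> inv v \<otimes> x \<in> gen_ball S n} \<le> card {n. n < R \<and> inv v \<otimes> (x \<otimes> s) \<in> gen_ball S n} + 1"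
proof -
  let ?A = "{n. n < R \<and> inv v \<otimes> x \<in> gen_ball S n}" and ?B = "{n. n < R \<and> inv v \<otimes> (x \<otimes> s) \<in> gen_ball S n}"
  have "inv v \<otimes> (x \<otimes> s) = inv v \<otimes> x \<otimes> s" using S s x v by (simp add: m_assoc subset_iff)
  then have "Suc ` ?A \<subseteq> insert R ?B" using s by auto
  then have "card (Suc ` ?A) \<le> card (insert R ?B)" by (intro card_mono) auto
  also have "\<dots> \<le> card ?B + 1" by (simp add: card_insert_if)
  finally show ?thesis by (simp add: card_image)
qed

text \<open>
  If no point of \<open>Q\<close> is in the ball of radius \<open>R - 1\<close> around a vertex \<open>v\<close> of the geodesic, then the tent
  of height \<open>R\<close> around \<open>v\<close> vanishes on \<open>Q\<close>, and the cut inequality for the single edge after \<open>v\<close> bounds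
  \<open>R\<close>. The last vertex has no edge after it, but it is in \<open>Q\<close>.
\<close>

theorem geodesic_stability:
  assumes V: "rel_gen_set V" and fill: "filling_ineq V S C" and C: "C \<ge> 0"
    and S: "finite S" "S \<subseteq> elt ` plain_alph V"
  shows "\<exists>Y. finite Y \<and> Y \<subseteq> carrier G \<and>
    (\<forall>g\<in>carrier G. \<forall>p\<in>lists (plain_alph V). \<forall>Q. length p = rdist V g (end_pt g p) \<longrightarrow>
      quasi_convex V lam Q \<longrightarrow> g \<in> Q \<longrightarrow> end_pt g p \<in> Q \<longrightarrow>
      (\<forall>v\<in>set (path_verts p g). \<exists>x\<in>Q. \<exists>y\<in>Y. v = x \<otimes> y))"
proof -
  define r where "r = nat \<lceil>32 * real (lam + 1) * C\<rceil>"
  \<comment> \<open>One more than the bound that the cut inequality with \<open>t - s = 1\<close> gives for the tent height.\<close>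
  define R where "R = nat \<lceil>8 * real (lam + 1) * C * real (1 + r + 1)\<rceil> + 1"
  define S' where "S' = S \<union> m_inv G ` S"
  have VG: "V \<subseteq> carrier G" using V by (simp add: rel_gen_set_def)
  have SG: "S \<subseteq> carrier G" using S(2) elt_closed[OF VG] by auto
  have S': "finite S'" "S' \<subseteq> carrier G" using S(1) SG by (auto simp: S'_def)
  define B where "B = (\<Union>n<R. gen_ball S' n)"
  have B: "finite B" "B \<subseteq> carrier G"
    using finite_gen_ball[OF S'(1)] gen_ball_closed[OF S'(2)] unfolding B_def by auto
  have oneB: "\<one> \<in> B" unfolding B_def using one_gen_ball R_def by auto
  have main: "\<exists>x\<in>Q. inv v \<otimes> x \<in> B"
    if g: "g \<in> carrier G" and p: "p \<in> lists (plain_alph V)" "length p = rdist V g (end_pt g p)"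
      and Q: "quasi_convex V lam Q" "g \<in> Q" "end_pt g p \<in> Q" and v: "v \<in> set (path_verts p g)" for g p Q v
  proof -
    obtain k where k: "k \<le> length p" "v = end_pt g (take k p)" using v set_path_verts by auto
    have vc: "v \<in> carrier G" using path_verts_closed[OF VG g p(1)] v by auto
    show ?thesis
    proof (cases "k = length p")
      case True
      then have "v \<in> Q" using k Q by simp
      then show ?thesis using oneB vc by (intro bexI[of _ v]) simp_all
    next
      case False
      show ?thesis
      proof (rule ccontr)
        assume far: "\<not> (\<exists>x\<in>Q. inv v \<otimes> x \<in> B)"
        define f where "f = (\<lambda>x. real (card {n. n < R \<and> inv v \<otimes> x \<in> gen_ball S' n}))"
        have lipschitz: "lipschitz S f" unfolding lipschitz_def
        proof (intro ballI)
          fix x s assume x: "x \<in> carrier G" and s: "s \<in> S"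
          \<comment> \<open>Membership of \<open>inv s\<close> in \<open>S'\<close> gives the estimate in the opposite direction.\<close>
          have s': "s \<in> S'" "inv s \<in> S'" "s \<in> carrier G" using s SG by (auto simp: S'_def)
          then have "x \<otimes> s \<in> carrier G" "x \<otimes> s \<otimes> inv s = x" using x by (simp_all add: m_assoc)
          then show "\<bar>f (x \<otimes> s) - f x\<bar> \<le> 1"
            using gen_ball_index_step[OF S'(2) s'(1) x vc, of R]
              gen_ball_index_step[OF S'(2) s'(2) _ vc, of "x \<otimes> s" R] unfolding f_def by simp
        qed
        have "(\<Sum>j=k..<k+1. f (end_pt g (take j p)))
            \<le> 8 * real (lam + 1) * C * real (k + 1 - k + r + 1)"
        proof (rule cut_inequality[OF V fill C g p Q _ lipschitz])
          show "\<exists>x\<in>Q. rdist V (end_pt g (take j p)) x \<le> r" if "j \<le> length p" for j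
            unfolding r_def using geodesic_near_quasi_convex[OF V fill C S(2) g p Q that] .
          show "f x = 0" if "x \<in> Q" for x
          proof -
            have none: "{n. n < R \<and> inv v \<otimes> x \<in> gen_ball S' n} = {}" using far that unfolding B_def by auto
            show ?thesis unfolding f_def none by simp
          qed
        qed (use k False in \<open>auto simp: f_def\<close>)
        moreover have "f v = real R"
        proof -
          have all: "{n. n < R \<and> inv v \<otimes> v \<in> gen_ball S' n} = {..<R}"
            using vc one_gen_ball by auto
          show ?thesis unfolding f_def all by simp
        qed
        ultimately have "real R \<le> 8 * real (lam + 1) * C * real (1 + r + 1)"
          using k by simp
        then show False unfolding R_def by linarith
      qed
    qed
  qed
  show ?thesis
  proof (intro exI[of _ "m_inv G ` B"] conjI ballI allI impI)
    show "finite (m_inv G ` B)" "m_inv G ` B \<subseteq> carrier G" using B by auto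
    fix g p Q v
    assume *: "g \<in> carrier G" "p \<in> lists (plain_alph V)" "length p = rdist V g (end_pt g p)"
      "quasi_convex V lam Q" "g \<in> Q" "end_pt g p \<in> Q" "v \<in> set (path_verts p g)"
    obtain x where x: "x \<in> Q" "inv v \<otimes> x \<in> B" using main[OF *] by blast
    have vc: "v \<in> carrier G" using path_verts_closed[OF VG *(1,2)] *(7) by auto
    have xc: "x \<in> carrier G" using x * by (auto simp: quasi_convex_def)
    have "v = x \<otimes> inv (inv v \<otimes> x)" using vc xc by (simp add: inv_mult_group m_assoc[symmetric])
    then show "\<exists>x\<in>Q. \<exists>y\<in>m_inv G ` B. v = x \<otimes> y" using x by blast
  qed
qed

section \<open>Enlarging the generating system\<close>

lemma rel_gen_set_if_contains_system:
  assumes X: "rel_gen_system G I H X" "val X ` letters X \<subseteq> V"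
    and V: "V \<subseteq> carrier G" "\<forall>s\<in>V. inv s \<in> V"
  shows "rel_gen_set V"
  unfolding rel_gen_set_def
proof (intro conjI ballI V(1))
  show "inv s \<in> V" if "s \<in> V" for s using V(2) that by blast
  fix x y assume xy: "x \<in> carrier G" "y \<in> carrier G"
  have sys: "is_system G X" using X by (simp add: rel_gen_system_def)
  obtain w where w: "w \<in> lists (alphabet G I H X)" "word_val G X w = inv x \<otimes> y"
    using generating_words[OF X(1), of "inv x \<otimes> y"] xy by auto
  have "end_pt x (plain_word X w) = y"
    using end_pt_plain_word[OF sys w(1) xy(1)] w(2) xy by (simp add: m_assoc[symmetric])
  moreover have "plain_word X w \<in> lists (plain_alph V)"
    using plain_word_alph[OF w(1)] lists_mono[OF plain_alph_mono[OF X(2)]] by blast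
  ultimately show "\<exists>w\<in>lists (plain_alph V). end_pt x w = y" by blast
qed

text \<open>
  By left invariance each element of the finite set \<open>V\<close> moves every point by a bounded distance over \<open>W\<close>;
  the peripheral letters are the same for both sets.
\<close>

lemma rdist_quasi_isometry:
  assumes V: "rel_gen_set V" "finite V" and W: "rel_gen_set W"
  shows "\<exists>lam. \<forall>x\<in>carrier G. \<forall>y\<in>carrier G. rdist W x y \<le> lam * rdist V x y"
proof -
  define lam where "lam = Max (insert 1 ((\<lambda>s. rdist W \<one> s) ` V))"
  have VG: "V \<subseteq> carrier G" "W \<subseteq> carrier G" using V W by (auto simp: rel_gen_set_def)
  have letter: "rdist W x (x \<otimes> elt z) \<le> lam" if z: "z \<in> plain_alph V" and x: "x \<in> carrier G" for x z
  proof (cases z)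
    case (Gen s)
    then have s: "s \<in> V" "s \<in> carrier G" using z VG by (auto simp: plain_alph_def)
    obtain w where w: "w \<in> lists (plain_alph W)" "length w = rdist W \<one> s" "end_pt \<one> w = s"
      using rdist_attained[OF W one_closed s(2)] .
    have "end_pt x w = x \<otimes> s" using end_pt_left_mult[OF VG(2) w(1) x one_closed] w x by simp
    then have "rdist W x (x \<otimes> s) \<le> rdist W \<one> s" using rdist_le[OF w(1), of x] w by simp
    also have "\<dots> \<le> lam" unfolding lam_def using s V by (intro Max_ge) auto
    finally show ?thesis using Gen by simp
  next
    case (Per i h)
    then have "rdist W x (x \<otimes> h) \<le> 1" using z x by (intro rdist_coset) (auto simp: plain_alph_def)
    also have "1 \<le> lam" unfolding lam_def using V by (intro Max_ge) auto
    finally show ?thesis using Per by simp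
  qed
  have path: "rdist W x (end_pt x w) \<le> lam * length w" if "w \<in> lists (plain_alph V)" "x \<in> carrier G" for x w
    using that
  proof (induction w arbitrary: x rule: list.induct)
    case (Cons z w)
    then have z: "z \<in> plain_alph V" "w \<in> lists (plain_alph V)" by auto
    have y: "x \<otimes> elt z \<in> carrier G" using elt_closed[OF VG(1) z(1)] Cons.prems by simp
    have e: "end_pt (x \<otimes> elt z) w \<in> carrier G" using end_pt_closed[OF VG(1) y z(2)] .
    show ?case
      using rdist_triangle[OF W Cons.prems(2) y e] letter[OF z(1) Cons.prems(2)] Cons.IH[OF z(2) y] by simp
  qed simp
  have "rdist W x y \<le> lam * rdist V x y" if xy: "x \<in> carrier G" "y \<in> carrier G" for x y
  proof -
    obtain w where w: "w \<in> lists (plain_alph V)" "length w = rdist V x y" "end_pt x w = y"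
      using rdist_attained[OF V(1) xy] .
    show ?thesis using path[OF w(1) xy(1)] w by simp
  qed
  then show ?thesis by blast
qed

lemma geodesic_quasi_convex:
  assumes W: "rel_gen_set W" and V: "rel_gen_set V" "W \<subseteq> V"
    and lam: "\<forall>x\<in>carrier G. \<forall>y\<in>carrier G. rdist W x y \<le> lam * rdist V x y"
    and g: "g \<in> carrier G" and q: "q \<in> lists (plain_alph W)" "length q = rdist W g (end_pt g q)"
  shows "quasi_convex V lam (set (path_verts q g))"
proof -
  let ?Q = "set (path_verts q g)"
  define pt where "pt = (\<lambda>j. end_pt g (take j q))"
  have WG: "W \<subseteq> carrier G" and VG: "V \<subseteq> carrier G" using W V by (auto simp: rel_gen_set_def)
  have Q: "?Q = pt ` {..length q}" unfolding set_path_verts pt_def by auto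
  have QG: "?Q \<subseteq> carrier G" using path_verts_closed[OF WG g q(1)] .
  have fw: "\<exists>w\<in>lists (plain_alph V). end_pt (pt i) w = pt j \<and> set (path_verts w (pt i)) \<subseteq> ?Q \<and> length w = j - i"
    if ij: "i \<le> j" "j \<le> length q" for i j
  proof (intro bexI conjI)
    let ?w = "take (j - i) (drop i q)"
    show "?w \<in> lists (plain_alph V)"
      using q(1) plain_alph_mono[OF V(2)] by (fastforce dest: in_set_takeD in_set_dropD)
    have e: "end_pt (pt i) (take k ?w) = pt (i + k)" if "k \<le> j - i" for k
      using that unfolding pt_def by (simp add: take_add flip: end_pt_simps(3))
    show "end_pt (pt i) ?w = pt j" using e[of "j - i"] ij by simp
    show "length ?w = j - i" using ij by simp
    then show "set (path_verts ?w (pt i)) \<subseteq> ?Q"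
      unfolding Q set_path_verts[of ?w] using e ij by auto
  qed
  have d: "rdist W (pt i) (pt j) = j - i" if "i \<le> j" "j \<le> length q" for i j
    unfolding pt_def using rdist_geodesic_verts[OF W g q that] .
  have ptc: "pt i \<in> carrier G" if "i \<le> length q" for i using that Q QG by auto
  have "\<exists>w\<in>lists (plain_alph V). end_pt x w = y \<and> set (path_verts w x) \<subseteq> ?Q \<and> length w \<le> lam * rdist V x y"
    if xy: "x \<in> ?Q" "y \<in> ?Q" for x y
  proof -
    obtain i j where ij: "x = pt i" "y = pt j" "i \<le> length q" "j \<le> length q" using xy Q by auto
    have xyc: "x \<in> carrier G" "y \<in> carrier G" using xy QG by auto
    show ?thesis
    proof (cases "i \<le> j")
      case True
      obtain w where "w \<in> lists (plain_alph V)" "end_pt x w = y" "set (path_verts w x) \<subseteq> ?Q" "length w = j - i"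
        using fw[OF True ij(4)] ij by blast
      moreover have "j - i \<le> lam * rdist V x y"
        using d[OF True ij(4)] lam xyc unfolding ij(1,2) by metis
      ultimately show ?thesis by auto
    next
      case False
      then have ji: "j \<le> i" by simp
      obtain w where w: "w \<in> lists (plain_alph V)" "end_pt y w = x" "set (path_verts w y) \<subseteq> ?Q" "length w = i - j"
        using fw[OF ji ij(3)] ij by blast
      have inv: "\<forall>s\<in>V. inv s \<in> V" using V(1) by (simp add: rel_gen_set_def)
      obtain w' where w': "w' \<in> lists (plain_alph V)" "length w' = length w" "end_pt x w' = y"
        "set (path_verts w' x) = set (path_verts w y)"
        using reverse_path[OF VG inv xyc(2) w(1)] w(2) by auto
      have "i - j \<le> lam * rdist V y x"
        using d[OF ji ij(3)] lam xyc unfolding ij(1,2) by metis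
      then have "length w' \<le> lam * rdist V x y"
        using w w' rdist_sym[OF V(1) xyc] by simp
      then show ?thesis using w(3) w' by (intro bexI[of _ w']) simp_all
    qed
  qed
  then show ?thesis unfolding quasi_convex_def using QG by blast
qed

lemma plain_word_surj:
  assumes "w \<in> lists (plain_alph (val X ` letters X))"
  shows "\<exists>w'\<in>lists (alphabet G I H X). plain_word X w' = w"
  using assms
proof (induction w rule: list.induct)
  case (Cons z w)
  then obtain w' where w': "w' \<in> lists (alphabet G I H X)" "plain_word X w' = w" by auto
  obtain y where "y \<in> alphabet G I H X" "map_letter (val X) (\<lambda>i. i) (\<lambda>h. h) y = z"
  proof (cases z)
    case (Gen s)
    then obtain x where "x \<in> letters X" "s = val X x" using Cons.prems by (auto simp: plain_alph_def)
    then show ?thesis using Gen that[of "Gen x"] by (auto simp: alphabet_def)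
  next
    case (Per i h)
    then show ?thesis using Cons.prems that[of "Per i h"] by (auto simp: plain_alph_def alphabet_def)
  qed
  then show ?case using w' by (intro bexI[of _ "y # w'"]) auto
qed (auto intro: bexI[of _ "[]"])

section \<open>Walks in the relative Cayley graph\<close>

lemma awalk_to_word:
  fixes X :: "('x, 'a) system"
  assumes "pre_digraph.awalk (rel_cayley_graph G I H X) g c v"
  shows "map snd c \<in> lists (alphabet G I H X)" "end_pt g (plain_word X (map snd c)) = v"
    "pre_digraph.awalk_verts (rel_cayley_graph G I H X) g c = path_verts (plain_word X (map snd c)) g"
proof -
  let ?\<Gamma> = "rel_cayley_graph G I H X"
  have "set c \<subseteq> arcs ?\<Gamma>" "pre_digraph.cas ?\<Gamma> g c v"
    using assms by (auto simp: pre_digraph.awalk_def)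
  then have "map snd c \<in> lists (alphabet G I H X) \<and> end_pt g (plain_word X (map snd c)) = v \<and>
    pre_digraph.awalk_verts ?\<Gamma> g c = path_verts (plain_word X (map snd c)) g"
    by (induction c arbitrary: g)
      (auto simp: pre_digraph.cas.simps pre_digraph.awalk_verts.simps rel_cayley_graph_def)
  then show "map snd c \<in> lists (alphabet G I H X)" "end_pt g (plain_word X (map snd c)) = v"
    "pre_digraph.awalk_verts ?\<Gamma> g c = path_verts (plain_word X (map snd c)) g" by auto
qed

lemma word_to_awalk:
  fixes X :: "('x, 'a) system"
  assumes X: "is_system G X" and g: "g \<in> carrier G" and w: "w \<in> lists (alphabet G I H X)"
  shows "\<exists>c. pre_digraph.awalk (rel_cayley_graph G I H X) g c (end_pt g (plain_word X w)) \<and> map snd c = w"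
  using g w
proof (induction w arbitrary: g rule: list.induct)
  case Nil
  then show ?case
    by (auto simp: pre_digraph.awalk_def pre_digraph.cas.simps rel_cayley_graph_def)
next
  case (Cons z w)
  interpret peripheral_system G I H X using X by (rule with_system)
  have z: "z \<in> alphabet G I H X" "w \<in> lists (alphabet G I H X)" using Cons.prems by auto
  have "g \<otimes> letter_val X z \<in> carrier G" using letter_val_closed[OF z(1)] Cons.prems by simp
  from Cons.IH[OF this z(2)] obtain c where c: "map snd c = w"
    "pre_digraph.awalk (rel_cayley_graph G I H X) (g \<otimes> letter_val X z) c
      (end_pt (g \<otimes> letter_val X z) (plain_word X w))" by blast
  then show ?case using z Cons.prems
    by (intro exI[of _ "(g, z) # c"])
      (auto simp: pre_digraph.awalk_def pre_digraph.cas.simps rel_cayley_graph_def)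
qed

lemma geodesic_to_word:
  fixes X :: "('x, 'a) system"
  assumes X: "is_system G X" and g: "g \<in> carrier G" and c: "geodesic (rel_cayley_graph G I H X) g c v"
    and rel_gen_set: "rel_gen_set (val X ` letters X)"
  defines "w \<equiv> plain_word X (map snd c)"
  shows "w \<in> lists (plain_alph (val X ` letters X))" "end_pt g w = v" "length w = rdist (val X ` letters X) g v"
    "pre_digraph.awalk_verts (rel_cayley_graph G I H X) g c = path_verts w g"
proof -
  let ?\<Gamma> = "rel_cayley_graph G I H X" and ?V = "val X ` letters X"
  have a: "pre_digraph.awalk ?\<Gamma> g c v" using c by (simp add: geodesic_def)
  show w: "w \<in> lists (plain_alph ?V)" unfolding w_def using plain_word_alph[OF awalk_to_word(1)[OF a]] .
  show e: "end_pt g w = v" unfolding w_def using awalk_to_word(2)[OF a] .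
  show "pre_digraph.awalk_verts ?\<Gamma> g c = path_verts w g" unfolding w_def using awalk_to_word(3)[OF a] .
  have "v \<in> carrier G" using end_pt_closed[OF _ g w] rel_gen_set e by (simp add: rel_gen_set_def)
  then obtain w' where w': "w' \<in> lists (plain_alph ?V)" "length w' = rdist ?V g v" "end_pt g w' = v"
    using rdist_attained[OF rel_gen_set g] by blast
  obtain x where x: "x \<in> lists (alphabet G I H X)" "plain_word X x = w'"
    using plain_word_surj[OF w'(1)] by blast
  obtain p where p: "pre_digraph.awalk ?\<Gamma> g p v" "map snd p = x"
    using word_to_awalk[OF X g x(1)] x(2) w'(3) by auto
  have "length c \<le> length p" using c p by (simp add: geodesic_def)
  also have "\<dots> = rdist ?V g v" using p x w'(2) by (metis length_map plain_word_simps(4))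
  finally have "length w \<le> rdist ?V g v" by (simp add: w_def)
  moreover have "rdist ?V g v \<le> length w" using rdist_le[OF w, of g] e by simp
  ultimately show "length w = rdist ?V g v" by simp
qed

lemma word_to_geodesic:
  fixes X :: "('x, 'a) system"
  assumes X: "is_system G X" and g: "g \<in> carrier G"
    and w: "w \<in> lists (plain_alph (val X ` letters X))" "length w = rdist (val X ` letters X) g (end_pt g w)"
  shows "\<exists>c. geodesic (rel_cayley_graph G I H X) g c (end_pt g w) \<and>
    pre_digraph.awalk_verts (rel_cayley_graph G I H X) g c = path_verts w g"
proof -
  let ?\<Gamma> = "rel_cayley_graph G I H X"
  obtain x where x: "x \<in> lists (alphabet G I H X)" "plain_word X x = w"
    using plain_word_surj[OF w(1)] by blast
  obtain c where c: "pre_digraph.awalk ?\<Gamma> g c (end_pt g w)" "map snd c = x"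
    using word_to_awalk[OF X g x(1)] x(2) by auto
  have lc: "length c = length w" using c(2) x(2) by (metis length_map plain_word_simps(4))
  have "length c \<le> length p" if p: "pre_digraph.awalk ?\<Gamma> g p (end_pt g w)" for p
    using rdist_le[OF plain_word_alph[OF awalk_to_word(1)[OF p]], of g] awalk_to_word(2)[OF p] w(2) lc
    by simp
  then show ?thesis using c awalk_to_word(3)[OF c(1)] x(2) by (auto simp: geodesic_def)
qed

section \<open>Quasiconvexity in terms of words\<close>

text \<open>
  Pre-quasiconvexity with respect to \<open>V\<close>. The union of \<open>L\<close> and \<open>L Y\<close> becomes \<open>L <#> Y\<close> once the identity is
  put into \<open>Y\<close>, which also covers the constant path.
\<close>

definition words_stay_near :: "'a set \<Rightarrow> 'a set \<Rightarrow> 'a set \<Rightarrow> bool" where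
  "words_stay_near V L Y \<longleftrightarrow> (\<forall>l\<in>L. \<forall>w\<in>lists (plain_alph V). end_pt l w \<in> L \<longrightarrow>
     length w = rdist V l (end_pt l w) \<longrightarrow> set (path_verts w l) \<subseteq> L <#> Y)"

lemma pre_quasiconvexD:
  assumes L: "L \<subseteq> carrier G" and qc: "pre_quasiconvex G I H L"
  shows "\<exists>V Y. finite V \<and> rel_gen_set V \<and> finite Y \<and> Y \<subseteq> carrier G \<and> words_stay_near V L Y"
proof -
  obtain X :: "(nat, 'a) system" and Y where X: "finite (letters X)" "rel_gen_system G I H X"
    and Y: "Y \<subseteq> carrier G" "finite Y"
    and near: "\<And>l1 l2 c. l1 \<in> L \<Longrightarrow> l2 \<in> L \<Longrightarrow> l1 \<noteq> l2 \<Longrightarrow> geodesic (rel_cayley_graph G I H X) l1 c l2 \<Longrightarrow>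
      set (pre_digraph.awalk_verts (rel_cayley_graph G I H X) l1 c) \<subseteq> L \<union> (L <#> Y)"
    using qc unfolding pre_quasiconvex_def by metis
  have sys: "is_system G X" using X by (simp add: rel_gen_system_def)
  let ?V = "val X ` letters X"
  have "?V \<subseteq> carrier G" "\<forall>s\<in>?V. inv s \<in> ?V"
    using sys unfolding is_system_def by (force intro: rev_image_eqI)+
  then have rel_gen_set: "rel_gen_set ?V" using rel_gen_set_if_contains_system[OF X(2)] by blast
  have grow: "L \<union> (L <#> Y) \<subseteq> L <#> insert \<one> Y" using L by (force simp: set_mult_def)
  have "words_stay_near ?V L (insert \<one> Y)"
    unfolding words_stay_near_def
  proof (intro ballI impI)
    fix l w assume l: "l \<in> L" and w: "w \<in> lists (plain_alph ?V)" "end_pt l w \<in> L"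
      "length w = rdist ?V l (end_pt l w)"
    have lc: "l \<in> carrier G" using l L by auto
    show "set (path_verts w l) \<subseteq> L <#> insert \<one> Y"
    proof (cases "end_pt l w = l")
      case True
      then have "w = []" using w(3) by simp
      then show ?thesis using l grow by auto
    next
      case False
      obtain c where c: "geodesic (rel_cayley_graph G I H X) l c (end_pt l w)"
        "pre_digraph.awalk_verts (rel_cayley_graph G I H X) l c = path_verts w l"
        using word_to_geodesic[OF sys lc w(1,3)] by blast
      show ?thesis
        using order_trans[OF near[OF l w(2) False[symmetric] c(1)] grow] unfolding c(2) .
    qed
  qed
  then show ?thesis using X(1) Y rel_gen_set
    by (intro exI[of _ ?V] exI[of _ "insert \<one> Y"]) simp
qed

text \<open>
  A geodesic over \<open>V\<close> between points of \<open>L\<close> is compared with a geodesic over \<open>W\<close> with the same ends. The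
  latter stays in \<open>L Y\<close>, its vertex set is quasi-convex over \<open>V\<close>, and stability provides another finite
  set \<open>Z\<close>, so that the former stays in \<open>L Y Z\<close>.
\<close>

lemma words_stay_near_change_generators:
  assumes L: "L \<subseteq> carrier G" and W: "rel_gen_set W" and V: "rel_gen_set V" "finite V" "W \<subseteq> V"
    and fill: "filling_ineq V S C" and C: "C \<ge> 0" and S: "finite S" "S \<subseteq> elt ` plain_alph V"
    and Y: "finite Y" "Y \<subseteq> carrier G" and near: "words_stay_near W L Y"
  shows "\<exists>Y'. finite Y' \<and> Y' \<subseteq> carrier G \<and> words_stay_near V L Y'"
proof -
  obtain lam where lam: "\<forall>x\<in>carrier G. \<forall>y\<in>carrier G. rdist W x y \<le> lam * rdist V x y"
    using rdist_quasi_isometry[OF V(1,2) W] by blast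
  obtain Z where Z: "finite Z" "Z \<subseteq> carrier G"
    and stab: "\<And>g p Q v. g \<in> carrier G \<Longrightarrow> p \<in> lists (plain_alph V) \<Longrightarrow> length p = rdist V g (end_pt g p) \<Longrightarrow>
      quasi_convex V lam Q \<Longrightarrow> g \<in> Q \<Longrightarrow> end_pt g p \<in> Q \<Longrightarrow> v \<in> set (path_verts p g) \<Longrightarrow>
      \<exists>x\<in>Q. \<exists>y\<in>Z. v = x \<otimes> y"
    using geodesic_stability[OF V(1) fill C S, of lam] by metis
  have "words_stay_near V L (Y <#> Z)"
    unfolding words_stay_near_def
  proof (intro ballI impI subsetI)
    fix l p v assume l: "l \<in> L" and p: "p \<in> lists (plain_alph V)" "end_pt l p \<in> L"
      "length p = rdist V l (end_pt l p)" and v: "v \<in> set (path_verts p l)"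
    have lc: "l \<in> carrier G" "end_pt l p \<in> carrier G" using l p L by auto
    obtain q where q: "q \<in> lists (plain_alph W)" "length q = rdist W l (end_pt l p)" "end_pt l q = end_pt l p"
      using rdist_attained[OF W lc] .
    have geo: "length q = rdist W l (end_pt l q)" using q by simp
    let ?Q = "set (path_verts q l)"
    have "end_pt l p \<in> ?Q" using path_verts_ends(2)[of l q] q(3) by simp
    then obtain x z where xz: "x \<in> ?Q" "z \<in> Z" "v = x \<otimes> z"
      using stab[OF lc(1) p(1,3) geodesic_quasi_convex[OF W V(1,3) lam lc(1) q(1) geo]
        path_verts_ends(1) _ v] by blast
    have "?Q \<subseteq> L <#> Y" using near l q(1) p(2) geo q(3) unfolding words_stay_near_def by simp
    then obtain k y where ky: "k \<in> L" "y \<in> Y" "x = k \<otimes> y" using xz(1) by (auto simp: set_mult_def)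
    have "v = k \<otimes> (y \<otimes> z)" using xz ky L Y Z by (simp add: m_assoc subset_iff)
    then show "v \<in> L <#> (Y <#> Z)" using ky xz by (auto simp: set_mult_def)
  qed
  moreover have "finite (Y <#> Z)" "Y <#> Z \<subseteq> carrier G"
    using Y Z by (auto simp: set_mult_def)
  ultimately show ?thesis by blast
qed

section \<open>Intersections\<close>

text \<open>
  If \<open>z\<close> is a common point of \<open>K a\<close> and \<open>L b\<close>, then \<open>K a = K z\<close> and \<open>L b = L z\<close>, so the two cosets meet
  in \<open>(K \<inter> L) z\<close>. One such point is chosen for each pair \<open>(a, b)\<close>.
\<close>

lemma finite_coset_unions_inter:
  assumes K: "subgroup K G" and L: "subgroup L G"
    and A: "finite A" "A \<subseteq> carrier G" and B: "finite B" "B \<subseteq> carrier G"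
  shows "\<exists>Z. finite Z \<and> Z \<subseteq> carrier G \<and> (K <#> A) \<inter> (L <#> B) \<subseteq> (K \<inter> L) <#> Z"
proof -
  define pick where "pick = (\<lambda>(a, b). SOME z. z \<in> (K #> a) \<inter> (L #> b))"
  define Z where "Z = pick ` {(a, b) \<in> A \<times> B. (K #> a) \<inter> (L #> b) \<noteq> {}}"
  have KL: "K \<subseteq> carrier G" "L \<subseteq> carrier G" using K L by (auto dest: subgroup.subset)
  have pick: "pick (a, b) \<in> (K #> a) \<inter> (L #> b)" if "(K #> a) \<inter> (L #> b) \<noteq> {}" for a b
    unfolding pick_def prod.case by (rule someI_ex) (use that in blast)
  have "finite Z" unfolding Z_def
    by (rule finite_imageI, rule finite_subset[of _ "A \<times> B"]) (use A B in auto)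
  moreover have "Z \<subseteq> carrier G"
  proof
    fix z assume "z \<in> Z"
    then obtain a b where "a \<in> A" "z \<in> K #> a" unfolding Z_def using pick by fastforce
    then show "z \<in> carrier G" using KL A by (auto simp: r_coset_def)
  qed
  moreover have "(K <#> A) \<inter> (L <#> B) \<subseteq> (K \<inter> L) <#> Z"
  proof
    fix v assume "v \<in> (K <#> A) \<inter> (L <#> B)"
    then obtain k a l b where v: "k \<in> K" "a \<in> A" "v = k \<otimes> a" "l \<in> L" "b \<in> B" "v = l \<otimes> b"
      by (auto simp: set_mult_def)
    then have ne: "(K #> a) \<inter> (L #> b) \<noteq> {}" by (auto simp: r_coset_def)
    define z where "z = pick (a, b)"
    have zZ: "z \<in> Z" unfolding Z_def z_def using v ne by blast
    have "z \<in> (K #> a) \<inter> (L #> b)" unfolding z_def using pick[OF ne] .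
    then obtain k' l' where z: "k' \<in> K" "z = k' \<otimes> a" "l' \<in> L" "z = l' \<otimes> b"
      by (auto simp: r_coset_def)
    have c: "k \<in> carrier G" "k' \<in> carrier G" "l \<in> carrier G" "l' \<in> carrier G" "a \<in> carrier G" "b \<in> carrier G"
      using v z KL A B by auto
    have "v \<otimes> inv z = k \<otimes> inv k'" unfolding v(3) z(2)
      using c by (simp add: inv_mult_group m_assoc) (simp add: m_assoc[symmetric])
    moreover have "v \<otimes> inv z = l \<otimes> inv l'" unfolding v(6) z(4)
      using c by (simp add: inv_mult_group m_assoc) (simp add: m_assoc[symmetric])
    moreover have "k \<otimes> inv k' \<in> K" "l \<otimes> inv l' \<in> L"
      using K L v z by (simp_all add: subgroup.m_closed subgroup.m_inv_closed)
    ultimately have "v \<otimes> inv z \<in> K \<inter> L" by simp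
    moreover have "v = v \<otimes> inv z \<otimes> z" using c z v by (simp add: m_assoc)
    ultimately show "v \<in> (K \<inter> L) <#> Z" using zZ unfolding set_mult_def by blast
  qed
  ultimately show ?thesis by blast
qed

text \<open>
  The finite set \<open>V\<close> is enumerated by natural numbers, and the involution is the one induced by inversion
  in the group.
\<close>

lemma system_with_values:
  assumes V: "finite V" "rel_gen_set V"
  shows "\<exists>X :: (nat, 'a) system. finite (letters X) \<and> rel_gen_system G I H X \<and> val X ` letters X = V"
proof -
  have VG: "V \<subseteq> carrier G" "\<forall>s\<in>V. inv s \<in> V" using V(2) by (auto simp: rel_gen_set_def)
  obtain e where e: "bij_betw e {0..<card V} V" using ex_bij_betw_nat_finite[OF V(1)] by blast
  let ?N = "{0..<card V}"
  define X :: "(nat, 'a) system" where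
    "X = \<lparr>letters = ?N, val = e, linv = (\<lambda>n. inv_into ?N e (inv (e n)))\<rparr>"
  have eV: "e n \<in> V" if "n \<in> ?N" for n using e that by (auto simp: bij_betw_def)
  have sys: "is_system G X" unfolding is_system_def
  proof (intro ballI conjI)
    fix n assume "n \<in> letters X"
    then have n: "n \<in> ?N" by (simp add: X_def)
    have s: "e n \<in> carrier G" "inv (e n) \<in> V" using eV[OF n] VG by auto
    then have i: "inv (e n) \<in> e ` ?N" using e by (simp add: bij_betw_def)
    have f: "e (inv_into ?N e (inv (e n))) = inv (e n)" using f_inv_into_f[OF i] .
    show "val X n \<in> carrier G" "val X (linv X n) = inv (val X n)" using s f by (simp_all add: X_def)
    show "linv X n \<in> letters X" using inv_into_into[OF i] by (simp add: X_def)
    show "linv X (linv X n) = n"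
      using f s e n by (simp add: X_def bij_betw_def inv_into_f_f)
  qed
  interpret peripheral_system G I H X using sys by (rule with_system)
  have vX: "val X ` letters X = V" using e by (simp add: X_def bij_betw_def)
  have "psi G X ` carrier (freeF G I H X) = carrier G"
  proof
    show "psi G X ` carrier (freeF G I H X) \<subseteq> carrier G" using psi_hom by (auto simp: hom_def)
    show "carrier G \<subseteq> psi G X ` carrier (freeF G I H X)"
    proof
      fix g assume g: "g \<in> carrier G"
      obtain w where w: "w \<in> lists (plain_alph V)" "end_pt \<one> w = g" using V(2) g unfolding rel_gen_set_def by blast
      obtain x where x: "x \<in> lists (alphabet G I H X)" "plain_word X x = w"
        using plain_word_surj[of w X] w vX by auto
      have "psi G X (cls G I H X x) = g"
        using psi_cls[OF x(1)] end_pt_plain_word[OF sys x(1) one_closed] x(2) w(2) word_val_closed[OF x(1)]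
        by simp
      then show "g \<in> psi G X ` carrier (freeF G I H X)" using x(1) by (auto simp: freeF_def)
    qed
  qed
  then show ?thesis using sys vX
    by (intro exI[of _ X]) (simp add: rel_gen_system_def, simp add: X_def)
qed

lemma pre_quasiconvexI:
  assumes V: "finite V" "rel_gen_set V" and Y: "finite Y" "Y \<subseteq> carrier G"
    and L: "L \<subseteq> carrier G" and near: "words_stay_near V L Y"
  shows "pre_quasiconvex G I H L"
proof -
  obtain X :: "(nat, 'a) system" where X: "finite (letters X)" "rel_gen_system G I H X" "val X ` letters X = V"
    using system_with_values[OF V] by blast
  have sys: "is_system G X" using X by (simp add: rel_gen_system_def)
  have "set (pre_digraph.awalk_verts (rel_cayley_graph G I H X) l1 c) \<subseteq> L \<union> (L <#> Y)"
    if l: "l1 \<in> L" "l2 \<in> L" and c: "geodesic (rel_cayley_graph G I H X) l1 c l2" for l1 l2 c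
  proof -
    have "l1 \<in> carrier G" "rel_gen_set (val X ` letters X)" using l L X V by auto
    note w = geodesic_to_word[OF sys this(1) c this(2), unfolded X(3)]
    have "set (path_verts (plain_word X (map snd c)) l1) \<subseteq> L <#> Y"
      using near l(1) w(1) l(2)[folded w(2)] w(3)[folded w(2)] unfolding words_stay_near_def by blast
    then show ?thesis unfolding w(4) by blast
  qed
  then show ?thesis unfolding pre_quasiconvex_def using X Y by blast
qed

text \<open>
  Since \<open>M y = M y'\<close> means that \<open>y y'\<^sup>-\<^sup>1\<close> is in \<open>M\<close>, the cosets of one of \<open>K\<close> and \<open>L\<close> differ if those of \<open>K \<inter> L\<close>
  do, and the finite set belonging to that subgroup contains the one in question.
\<close>

lemma condition_b_inter:
  assumes K: "subgroup K G" and L: "subgroup L G"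
    and b: "condition_b G I H K" "condition_b G I H L"
  shows "condition_b G I H (K \<inter> L)"
  unfolding condition_b_def
proof (intro ballI impI)
  fix y y' assume y: "y \<in> carrier G" "y' \<in> carrier G" and ne: "(K \<inter> L) #> y \<noteq> (K \<inter> L) #> y'"
  have KL: "subgroup (K \<inter> L) G" using subgroups_Inter_pair[OF K L] .
  have eq: "M #> y = M #> y' \<longleftrightarrow> y \<otimes> inv y' \<in> M" if M: "subgroup M G" for M
  proof
    assume "M #> y = M #> y'"
    then have "y \<in> M #> y'" using rcos_self[OF y(1) M] by simp
    then obtain m where "m \<in> M" "y = m \<otimes> y'" by (auto simp: r_coset_def)
    then show "y \<otimes> inv y' \<in> M" using y subgroup.mem_carrier[OF M] by (simp add: m_assoc)
  next
    assume m: "y \<otimes> inv y' \<in> M"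
    have "y = (y \<otimes> inv y') \<otimes> y'" using y by (simp add: m_assoc)
    then have "y \<in> M #> y'" using m unfolding r_coset_def by blast
    then show "M #> y = M #> y'" using repr_independence[OF _ y(2) M] by simp
  qed
  have "K #> y \<noteq> K #> y' \<or> L #> y \<noteq> L #> y'"
    using ne unfolding eq[OF KL] eq[OF K] eq[OF L] by blast
  then obtain M where M: "condition_b G I H M" "M #> y \<noteq> M #> y'" "K \<inter> L \<subseteq> M" using b by blast
  then have "finite {i \<in> I. M \<inter> ((y <# H i) #> inv y') \<noteq> {}}"
    using y unfolding condition_b_def by blast
  then show "finite {i \<in> I. K \<inter> L \<inter> ((y <# H i) #> inv y') \<noteq> {}}"
    by (rule rev_finite_subset) (use M(3) in blast)
qed

theorem quasiconvex_inter:
  assumes K: "subgroup K G" and L: "subgroup L G" and hyp: "rel_hyperbolic G I H"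
    and qc: "rel_quasiconvex G I H K" "rel_quasiconvex G I H L"
  shows "rel_quasiconvex G I H (K \<inter> L)"
proof -
  have KL: "K \<subseteq> carrier G" "L \<subseteq> carrier G" using K L by (auto dest: subgroup.subset)
  obtain X :: "(nat, 'a) system" and R a b where X: "finite (letters X)" "finite R"
    "rel_presentation G I H X R" "rel_dehn_well_defined G I H X R"
    and lin: "\<And>n. real (rel_dehn G I H X R n) \<le> a * real n + b"
    using hyp unfolding rel_hyperbolic_def by blast
  obtain V1 Y1 where 1: "finite V1" "rel_gen_set V1" "finite Y1" "Y1 \<subseteq> carrier G" "words_stay_near V1 K Y1"
    using pre_quasiconvexD[OF KL(1)] qc(1) unfolding rel_quasiconvex_def by blast
  obtain V2 Y2 where 2: "finite V2" "rel_gen_set V2" "finite Y2" "Y2 \<subseteq> carrier G" "words_stay_near V2 L Y2"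
    using pre_quasiconvexD[OF KL(2)] qc(2) unfolding rel_quasiconvex_def by blast
  define V where "V = val X ` letters X \<union> V1 \<union> V2"
  have gs: "rel_gen_system G I H X" and sys: "is_system G X"
    using X(3) by (auto simp: rel_presentation_def rel_gen_system_def)
  have "val X ` letters X \<subseteq> carrier G" "\<forall>s\<in>val X ` letters X. inv s \<in> val X ` letters X"
    using sys unfolding is_system_def by (force intro: rev_image_eqI)+
  then have VG: "V \<subseteq> carrier G" "\<forall>s\<in>V. inv s \<in> V"
    using 1(2) 2(2) unfolding V_def rel_gen_set_def by blast+
  have V: "rel_gen_set V" "finite V" "V1 \<subseteq> V" "V2 \<subseteq> V"
    using rel_gen_set_if_contains_system[OF gs _ VG] X 1(1) 2(1) unfolding V_def by auto
  obtain S C where SC: "finite S" "S \<subseteq> elt ` plain_alph V" "C \<ge> 0" "filling_ineq V S C"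
    using linear_filling[OF X lin V(2) VG(1)] unfolding V_def by blast
  obtain A where A: "finite A" "A \<subseteq> carrier G" "words_stay_near V K A"
    using words_stay_near_change_generators[OF KL(1) 1(2) V(1,2,3) SC(4,3,1,2) 1(3,4,5)] by blast
  obtain B where B: "finite B" "B \<subseteq> carrier G" "words_stay_near V L B"
    using words_stay_near_change_generators[OF KL(2) 2(2) V(1,2,4) SC(4,3,1,2) 2(3,4,5)] by blast
  obtain Z where Z: "finite Z" "Z \<subseteq> carrier G" "(K <#> A) \<inter> (L <#> B) \<subseteq> (K \<inter> L) <#> Z"
    using finite_coset_unions_inter[OF K L A(1,2) B(1,2)] by blast
  have "words_stay_near V (K \<inter> L) Z"
    unfolding words_stay_near_def
  proof (intro ballI impI)
    fix l w assume w: "l \<in> K \<inter> L" "w \<in> lists (plain_alph V)" "end_pt l w \<in> K \<inter> L"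
      "length w = rdist V l (end_pt l w)"
    then have "set (path_verts w l) \<subseteq> K <#> A" "set (path_verts w l) \<subseteq> L <#> B"
      using A(3) B(3) unfolding words_stay_near_def by blast+
    then show "set (path_verts w l) \<subseteq> (K \<inter> L) <#> Z" using Z(3) by blast
  qed
  then have "pre_quasiconvex G I H (K \<inter> L)"
    using KL by (intro pre_quasiconvexI[OF V(2,1) Z(1,2)]) auto
  then show ?thesis
    using condition_b_inter[OF K L] qc unfolding rel_quasiconvex_def by blast
qed

end

theorem theorem1p3:
  fixes G :: "('a, 'b) monoid_scheme" and I :: "'i set" and H :: "'i \<Rightarrow> 'a set" and K L :: "'a set"
  assumes "group G"
    and "\<And>i. i \<in> I \<Longrightarrow> subgroup (H i) G"
    and "\<And>i. i \<in> I \<Longrightarrow> H i \<noteq> {\<one>\<^bsub>G\<^esub>}"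
    and "subgroup K G" and "subgroup L G"
    and "rel_hyperbolic G I H"
    and "rel_quasiconvex G I H K" and "rel_quasiconvex G I H L"
  shows "rel_quasiconvex G I H (K \<inter> L)"
proof -
  interpret peripheral_family G I H
    using assms(1,2) by (simp add: peripheral_family_def peripheral_family_axioms_def)
  show ?thesis using assms(4-8) by (rule quasiconvex_inter)
qed

end
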